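(* Let $X$ be a $\mathbb{Z}^2$-subshift of finite type which is $f$-block gluing, where the non-decreasing function $f:\mathbb{N}\to\mathbb{N}$ satisfies $f(n)\in o(\log n)$ and $f\le\mathrm{id}$ (i.e. $f(n)\le n$ for all $n$). Then the entropy $h(X)$ is a computable real number.
   Context: Let $\mathcal{A}$ be a finite alphabet; $\mathcal{A}^{\mathbb{Z}^2}$ carries the product of the discrete topologies, and the shift is $(\sigma^{u}x)_{v}=x_{u+v}$ for $u,v\in\mathbb{Z}^2$. A $\mathbb{Z}^2$-subshift is a nonempty compact subset $X\subset\mathcal{A}^{\mathbb{Z}^2}$ with $\sigma^{u}X\subset X$ for all $u\in\mathbb{Z}^2$. It is of finite type (SFT) if it is the set of configurations in which no translate of a pattern from some fixed finite set of patterns on finite supports appears. An $n$-block is an element of $\mathcal{A}^{\{0,\dots,n-1\}^2}$; it is in the language of $X$ if it appears in a configuration of $X$, and $N_n(X)$ denotes the number of $n$-blocks in the language of $X$. The entropy is $h(X)=\inf_{n\ge1}\frac{\log_2 N_n(X)}{n^2}$. For $n$-blocks $p,q$ in the language of $X$, $$\Delta_X(p,q)=\{u\in\mathbb{Z}^2:\ \exists x\in X,\ x_{\{0,\dots,n-1\}^2}=q\ \text{and}\ x_{u+\{0,\dots,n-1\}^2}=p\}.$$ $X$ is $f$-block gluing if for every $n$ and all $n$-blocks $p,q$ in the language of $X$, every $u\in\mathbb{Z}^2$ with $\|u\|_\infty\ge n+f(n)$ belongs to $\Delta_X(p,q)$. A real number $x$ is computable if there is an algorithm which, on input an integer $n$,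 outputs a rational $r_n$ with $|x-r_n|\le 2^{-n}$. *)

theory Defs
  imports
    "HOL-Analysis.Function_Topology"
    "HOL-Library.Landau_Symbols"
    "HOL-Library.Countable"
begin

section \<open>Subshifts over the two-dimensional integer lattice\<close>

type_synonym 'a config = "int \<times> int \<Rightarrow> 'a"

definition shift :: "int \<times> int \<Rightarrow> 'a config \<Rightarrow> 'a config" where
  "shift u x = (\<lambda>v. x (u + v))"

definition config_topology :: "'a config topology" where
  "config_topology = product_topology (\<lambda>_. discrete_topology UNIV) UNIV"

definition subshift :: "'a config set \<Rightarrow> bool" where
  "subshift X \<longleftrightarrow>
     X \<noteq> {} \<and> compactin config_topology X \<and> (\<forall>u. shift u ` X \<subseteq> X)"

text \<open>A pattern is a partial map whose domain is its support.\<close>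

type_synonym 'a pattern = "int \<times> int \<rightharpoonup> 'a"

definition occurs_at :: "'a pattern \<Rightarrow> int \<times> int \<Rightarrow> 'a config \<Rightarrow> bool" where
  "occurs_at p u x \<longleftrightarrow> (\<forall>v\<in>dom p. p v = Some (x (u + v)))"

definition appears_in :: "'a pattern \<Rightarrow> 'a config \<Rightarrow> bool" where
  "appears_in p x \<longleftrightarrow> (\<exists>u. occurs_at p u x)"

definition finite_type :: "'a config set \<Rightarrow> bool" where
  "finite_type X \<longleftrightarrow>
     (\<exists>F. finite F \<and> (\<forall>p\<in>F. finite (dom p)) \<and> X = {x. \<forall>p\<in>F. \<not> appears_in p x})"

definition square :: "nat \<Rightarrow> (int \<times> int) set" where
  "square n = {0..<int n} \<times> {0..<int n}"

definition language :: "nat \<Rightarrow> 'a config set \<Rightarrow> 'a pattern set" where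
  "language n X = {p. dom p = square n \<and> (\<exists>x\<in>X. appears_in p x)}"

definition entropy :: "'a config set \<Rightarrow> real" where
  "entropy X = (INF n\<in>{1..}. log 2 (real (card (language n X))) / real n ^ 2)"

definition gluing_set :: "'a config set \<Rightarrow> 'a pattern \<Rightarrow> 'a pattern \<Rightarrow> (int \<times> int) set" where
  "gluing_set X p q = {u. \<exists>x\<in>X. occurs_at q 0 x \<and> occurs_at p u x}"

definition sup_norm :: "int \<times> int \<Rightarrow> int" where
  "sup_norm u = max \<bar>fst u\<bar> \<bar>snd u\<bar>"

definition block_gluing :: "(nat \<Rightarrow> nat) \<Rightarrow> 'a config set \<Rightarrow> bool" where
  "block_gluing f X \<longleftrightarrow>
     (\<forall>n. \<forall>p\<in>language n X. \<forall>q\<in>language n X. \<forall>u.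
        sup_norm u \<ge> int (n + f n) \<longrightarrow> u \<in> gluing_set X p q)"


section \<open>Computable real numbers\<close>

text \<open>
  Algorithms are rendered as programs for the partial recursive functions: zero, successor,
  projections, composition, primitive recursion and unbounded minimisation. Programs carry no
  arity; the arity is that of the argument list, and ill-formed applications have no result.
\<close>

datatype recf =
    Zero
  | Succ
  | Proj nat
  | Comp recf "recf list"
  | PrimRec recf recf
  | Mu recf

inductive computes :: "recf \<Rightarrow> nat list \<Rightarrow> nat \<Rightarrow> bool" where
  zero: "computes Zero xs 0"
| succ: "computes Succ [x] (Suc x)"
| proj: "i < length xs \<Longrightarrow> computes (Proj i) xs (xs ! i)"
| comp: "list_all2 (\<lambda>g y. computes g xs y) gs ys \<Longrightarrow> computes f ys z
           \<Longrightarrow> computes (Comp f gs) xs z"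
| prim_rec_0: "computes f xs y \<Longrightarrow> computes (PrimRec f g) (0 # xs) y"
| prim_rec_Suc: "computes (PrimRec f g) (n # xs) y \<Longrightarrow> computes g (n # y # xs) z
           \<Longrightarrow> computes (PrimRec f g) (Suc n # xs) z"
| mu: "computes f (n # xs) 0 \<Longrightarrow> (\<And>m. m < n \<Longrightarrow> \<exists>y. computes f (m # xs) (Suc y))
           \<Longrightarrow> computes (Mu f) xs n"

inductive_cases computes_ZeroE: "computes Zero xs z"
inductive_cases computes_SuccE: "computes Succ xs z"
inductive_cases computes_ProjE: "computes (Proj i) xs z"
inductive_cases computes_CompE: "computes (Comp f gs) xs z"
inductive_cases computes_PrimRec_0E: "computes (PrimRec f g) (0 # xs) z"
inductive_cases computes_PrimRec_SucE: "computes (PrimRec f g) (Suc n # xs) z"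
inductive_cases computes_MuE: "computes (Mu f) xs z"

lemma computes_deterministic: "computes r xs y \<Longrightarrow> computes r xs z \<Longrightarrow> y = z"
proof (induction arbitrary: z rule: computes.induct)
  case (zero xs)
  then show ?case by (rule computes_ZeroE) simp
next
  case (succ x)
  then show ?case by (rule computes_SuccE) simp
next
  case (proj i xs)
  from proj.prems show ?case by (rule computes_ProjE) simp
next
  case (comp xs gs ys f z')
  from comp.prems obtain zs where
    zs: "list_all2 (\<lambda>g y. computes g xs y) gs zs" "computes f zs z"
    by (rule computes_CompE)
  have "ys = zs"
    using comp.IH(1) zs(1)
  proof (induction arbitrary: zs rule: list_all2_induct)
    case Nil
    then show ?case by simp
  next
    case (Cons g gs' y ys')
    then show ?case by (cases zs) auto
  qed
  then show ?case using comp.IH(2) zs(2) by blast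
next
  case (prim_rec_0 f xs y g)
  from prim_rec_0.prems have "computes f xs z" by (rule computes_PrimRec_0E)
  then show ?case by (rule prim_rec_0.IH)
next
  case (prim_rec_Suc f g n xs y z')
  from prim_rec_Suc.prems obtain y' where
    "computes (PrimRec f g) (n # xs) y'" "computes g (n # y' # xs) z"
    by (rule computes_PrimRec_SucE)
  then show ?case using prim_rec_Suc.IH by blast
next
  case (mu f n xs)
  from mu.prems show ?case
  proof (rule computes_MuE)
    assume z: "computes f (z # xs) 0" "\<And>m. m < z \<Longrightarrow> \<exists>y. computes f (m # xs) (Suc y)"
    have "\<not> n < z"
    proof
      assume "n < z"
      then obtain y where "computes f (n # xs) (Suc y)" using z(2) by blast
      then show False using mu.IH(1) by blast
    qed
    moreover have "\<not> z < n"
    proof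
      assume "z < n"
      then obtain y where "\<And>w. computes f (z # xs) w \<Longrightarrow> Suc y = w" using mu.IH(2) by blast
      then show False using z(1) by blast
    qed
    ultimately show "n = z" by simp
  qed
qed

definition computable_fun :: "(nat \<Rightarrow> nat) \<Rightarrow> bool" where
  "computable_fun g \<longleftrightarrow> (\<exists>r. \<forall>n. computes r [n] (g n))"

text \<open>
  The integer input and the rational output are coded by natural numbers;
  \<^const>\<open>nat_to_rat_surj\<close> decodes a pair of coded integers to their quotient.
\<close>

definition computable_real :: "real \<Rightarrow> bool" where
  "computable_real x \<longleftrightarrow>
     (\<exists>g. computable_fun g \<and>
        (\<forall>n::int. \<bar>x - of_rat (nat_to_rat_surj (g (int_encode n)))\<bar> \<le> 2 powi (- n)))"

end

(*
  Let N(n) be the number of n-blocks in the language.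

  Gluing gives N(2m + f(3m)) >= N(m)^4. Iterating this, and comparing with N(M) <= N(n)^(q^2) for
  M <= q n, yields  log N(m) / (m + 4 sqrt m)^2 <= h(X) <= log N(m) / m^2  for all large m, so that
  log N(m) / m^2 approximates h(X) with an explicit error of order 1 / sqrt m.

  For large n the function N is computable: since f is o(log), a row of exponentially many copies of
  an n-block p, glued to a copy of itself, leaves a vertical gap of height at most n, so that there
  are fewer possible columns than copies of p. By the pigeonhole principle p occurs in a doubly
  periodic configuration of X whose periods divide an explicit factorial T(n). Hence N(n) is the
  number of n-blocks that occur as the corner of a T(n) x T(n) torus without forbidden patterns,
  which is a primitive recursive count. The function f enters the algorithm only through a
  threshold for n, so f itself need not be computable.
*)
theory Submission
  imports
    Defs
    "HOL-Library.Discrete_Functions"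
begin

section \<open>Closure properties of recursive functions\<close>

text \<open>The obstacle is deciding which blocks are in the language: exhaustive search only ever
  refutes membership, so for a general SFT the entropy is approximable merely from above. A periodic
  configuration is a finite certificate of membership, and gluing provides one of controlled period
  for every block. The construction has a loop to close. The number of copies in the row must exceed
  the number of columns, which is exponential in the height of a column; that height contains the
  gap, and the gap depends on the length of the row. With f in o(log), a row of length exponential
  in n still has gap at most n, whatever the alphabet and the window size of the SFT, so height 2n
  is consistent. The pigeonhole principle does not control which two copies are selected, so the
  horizontal period varies with the block. The factorial is a multiple of all candidates, and one
  torus size serves all n-blocks. Since the entropy is an infimum over all n, a lower bound must
  hold against every n: for fixed n, ever larger blocks of the iterated gluing are tiled by
  n-blocks, so that the rounding error vanishes in the limit.\<close>

definition rfun :: "nat \<Rightarrow> (nat list \<Rightarrow> nat) \<Rightarrow> bool" where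
  "rfun k F \<longleftrightarrow> (\<exists>r. \<forall>xs. length xs = k \<longrightarrow> computes r xs (F xs))"

definition rpred :: "nat \<Rightarrow> (nat list \<Rightarrow> bool) \<Rightarrow> bool" where
  "rpred k P \<longleftrightarrow> rfun k (\<lambda>xs. of_bool (P xs))"

lemma rfun_cong: "rfun k F \<Longrightarrow> (\<And>xs. length xs = k \<Longrightarrow> F xs = G xs) \<Longrightarrow> rfun k G"
  unfolding rfun_def by metis

lemma rfun_nth: "i < k \<Longrightarrow> rfun k (\<lambda>xs. xs ! i)"
  unfolding rfun_def using computes.proj by blast

lemma rfun_compose:
  assumes "rfun (length Fs) G" and "\<And>F. F \<in> set Fs \<Longrightarrow> rfun k F"
  shows "rfun k (\<lambda>xs. G (map (\<lambda>F. F xs) Fs))"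
proof -
  obtain r where r: "\<And>xs. length xs = length Fs \<Longrightarrow> computes r xs (G xs)"
    using assms(1) unfolding rfun_def by blast
  have "\<forall>F\<in>set Fs. \<exists>q. \<forall>xs. length xs = k \<longrightarrow> computes q xs (F xs)"
    using assms(2) unfolding rfun_def by blast
  then obtain q where q: "\<And>F xs. F \<in> set Fs \<Longrightarrow> length xs = k \<Longrightarrow> computes (q F) xs (F xs)"
    by metis
  have "computes (Comp r (map q Fs)) xs (G (map (\<lambda>F. F xs) Fs))" if "length xs = k" for xs
  proof (rule computes.comp)
    show "list_all2 (\<lambda>g y. computes g xs y) (map q Fs) (map (\<lambda>F. F xs) Fs)"
      using q that by (auto simp: list_all2_conv_all_nth)
    show "computes r (map (\<lambda>F. F xs) Fs) (G (map (\<lambda>F. F xs) Fs))"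
      by (simp add: r)
  qed
  then show ?thesis unfolding rfun_def by blast
qed

lemma rfun_Suc: "rfun k F \<Longrightarrow> rfun k (\<lambda>xs. Suc (F xs))"
proof -
  assume F: "rfun k F"
  have "rfun 1 (\<lambda>xs. Suc (hd xs))"
    unfolding rfun_def
  proof (intro exI allI impI)
    fix xs :: "nat list" assume "length xs = 1"
    then obtain x where "xs = [x]" by (auto simp: length_Suc_conv)
    then show "computes Succ xs (Suc (hd xs))" by (simp add: computes.succ)
  qed
  then show ?thesis
    using rfun_compose[of "[F]" "\<lambda>xs. Suc (hd xs)" k] F by simp
qed

lemma rfun_const: "rfun k (\<lambda>xs. c)"
proof (induction c)
  case 0
  show ?case unfolding rfun_def using computes.zero by blast
qed (rule rfun_Suc)

text \<open>In a primitive recursion the step sees counter, accumulator and parameters, but the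
  terms of a sum or product see only counter and parameters. Composing with projections drops the
  accumulator.\<close>

lemma rfun_skip:
  assumes "rfun (Suc k) (\<lambda>ys. G (hd ys) (tl ys))"
  shows "rfun (Suc (Suc k)) (\<lambda>ys. G (hd ys) (tl (tl ys)))"
proof -
  let ?Fs = "(\<lambda>xs. xs ! 0) # map (\<lambda>i xs. xs ! (Suc (Suc i))) [0..<k]"
  have "rfun (Suc (Suc k)) (\<lambda>xs. (\<lambda>ys. G (hd ys) (tl ys)) (map (\<lambda>F. F xs) ?Fs))"
    by (rule rfun_compose) (auto simp: assms intro: rfun_nth)
  then show ?thesis
  proof (rule rfun_cong)
    fix xs :: "nat list" assume "length xs = Suc (Suc k)"
    then obtain x y zs where "xs = x # y # zs" "length zs = k" by (auto simp: length_Suc_conv)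
    then show "G (hd (map (\<lambda>F. F xs) ?Fs)) (tl (map (\<lambda>F. F xs) ?Fs)) = G (hd xs) (tl (tl xs))"
      using map_nth[of zs] by (simp add: comp_def)
  qed
qed

lemma rfun_let:
  assumes "rfun k N" and "rfun (Suc k) (\<lambda>ys. G (hd ys) (tl ys))"
  shows "rfun k (\<lambda>xs. G (N xs) xs)"
proof -
  let ?Fs = "N # map (\<lambda>i xs. xs ! i) [0..<k]"
  have "rfun k (\<lambda>xs. (\<lambda>ys. G (hd ys) (tl ys)) (map (\<lambda>F. F xs) ?Fs))"
    by (rule rfun_compose) (auto simp: assms intro: rfun_nth)
  then show ?thesis
    by (rule rfun_cong) (auto simp: comp_def map_nth)
qed

text \<open>\<open>PrimRec\<close> recurses on the head of its argument list;
  \<open>rfun_let\<close> then puts the computed bound in that position.\<close>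

lemma rfun_rec_nat:
  assumes N: "rfun k N" and B: "rfun k B"
    and S: "rfun (Suc (Suc k)) (\<lambda>ys. S (hd ys) (hd (tl ys)) (tl (tl ys)))"
  shows "rfun k (\<lambda>xs. rec_nat (B xs) (\<lambda>n y. S n y xs) (N xs))"
proof -
  obtain b where b: "\<And>xs. length xs = k \<Longrightarrow> computes b xs (B xs)"
    using B unfolding rfun_def by blast
  obtain s where s: "\<And>xs. length xs = Suc (Suc k) \<Longrightarrow>
      computes s xs (S (hd xs) (hd (tl xs)) (tl (tl xs)))"
    using S unfolding rfun_def by blast
  have *: "computes (PrimRec b s) (n # xs) (rec_nat (B xs) (\<lambda>n y. S n y xs) n)"
    if "length xs = k" for n xs
  proof (induction n)
    case 0
    show ?case using b that by (simp add: computes.prim_rec_0)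
  next
    case (Suc n)
    show ?case
      using computes.prim_rec_Suc[OF Suc.IH] s[of "n # _ # xs"] that by simp
  qed
  have "rfun (Suc k) (\<lambda>ys. rec_nat (B (tl ys)) (\<lambda>n y. S n y (tl ys)) (hd ys))"
    unfolding rfun_def
  proof (intro exI allI impI)
    fix ys :: "nat list" assume "length ys = Suc k"
    then obtain n xs where "ys = n # xs" "length xs = k" by (auto simp: length_Suc_conv)
    then show "computes (PrimRec b s) ys (rec_nat (B (tl ys)) (\<lambda>n y. S n y (tl ys)) (hd ys))"
      using * by simp
  qed
  from rfun_let[OF N this] show ?thesis .
qed

lemma rfun_hd_drop: "i < k \<Longrightarrow> rfun k (\<lambda>xs. hd (drop i xs))"
  by (rule rfun_cong[OF rfun_nth]) (auto simp: hd_drop_conv_nth)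

text \<open>Variables are written with \<open>hd\<close> and \<open>tl\<close> because binding a new
  variable replaces \<open>xs\<close> by \<open>tl ys\<close>; an old variable then keeps this shape
  and the rules still match by unification.\<close>

lemma rfun_var:
  "0 < k \<Longrightarrow> rfun k (\<lambda>xs. hd xs)"
  "1 < k \<Longrightarrow> rfun k (\<lambda>xs. hd (tl xs))"
  "2 < k \<Longrightarrow> rfun k (\<lambda>xs. hd (tl (tl xs)))"
  "3 < k \<Longrightarrow> rfun k (\<lambda>xs. hd (tl (tl (tl xs))))"
  "4 < k \<Longrightarrow> rfun k (\<lambda>xs. hd (tl (tl (tl (tl xs)))))"
  "5 < k \<Longrightarrow> rfun k (\<lambda>xs. hd (tl (tl (tl (tl (tl xs))))))"
  using rfun_hd_drop[of 0 k] rfun_hd_drop[of 1 k] rfun_hd_drop[of 2 k] rfun_hd_drop[of 3 k]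
    rfun_hd_drop[of 4 k] rfun_hd_drop[of 5 k]
  by (simp_all add: drop_Suc numeral_eq_Suc)

text \<open>A function shown recursive at its own small arity becomes available in any context. This
  avoids weakening the arguments under the binders of sums and recursions.\<close>

lemma rfun_call1:
  assumes "rfun 1 (\<lambda>xs. G (hd xs))" "rfun k A"
  shows "rfun k (\<lambda>xs. G (A xs))"
  using rfun_compose[of "[A]" "\<lambda>xs. G (hd xs)" k] assms by simp

lemma rfun_call2:
  assumes "rfun 2 (\<lambda>xs. G (hd xs) (hd (tl xs)))" "rfun k A" "rfun k B"
  shows "rfun k (\<lambda>xs. G (A xs) (B xs))"
  using rfun_compose[of "[A, B]" "\<lambda>xs. G (hd xs) (hd (tl xs))" k] assms
  by (auto simp: numeral_2_eq_2)

lemma rfun_call4: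
  assumes "rfun 4 (\<lambda>xs. G (hd xs) (hd (tl xs)) (hd (tl (tl xs))) (hd (tl (tl (tl xs)))))"
    "rfun k A" "rfun k B" "rfun k C" "rfun k D"
  shows "rfun k (\<lambda>xs. G (A xs) (B xs) (C xs) (D xs))"
  using rfun_compose[of "[A, B, C, D]"
      "\<lambda>xs. G (hd xs) (hd (tl xs)) (hd (tl (tl xs))) (hd (tl (tl (tl xs))))" k] assms
  by (auto simp: eval_nat_numeral)

section \<open>Arithmetic, bounded sums and products\<close>

lemma rfun_add:
  assumes "rfun k A" "rfun k B"
  shows "rfun k (\<lambda>xs. A xs + B xs)"
proof -
  have *: "rec_nat b (\<lambda>n y. Suc y) a = a + b" for a b :: nat by (induction a) auto
  have "rfun k (\<lambda>xs. rec_nat (B xs) (\<lambda>n y. Suc y) (A xs))"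
    by (intro rfun_rec_nat assms rfun_Suc rfun_var) simp
  then show ?thesis by (simp only: *)
qed

lemma rfun_sum:
  assumes "rfun k N" "rfun (Suc k) (\<lambda>ys. G (hd ys) (tl ys))"
  shows "rfun k (\<lambda>xs. \<Sum>i<N xs. G i xs)"
proof -
  have *: "rec_nat 0 (\<lambda>i y. y + g i) n = (\<Sum>i<n. g i)" for n and g :: "nat \<Rightarrow> nat"
    by (induction n) auto
  have "rfun k (\<lambda>xs. rec_nat 0 (\<lambda>i y. y + G i xs) (N xs))"
    by (intro rfun_rec_nat assms rfun_add rfun_var rfun_const rfun_skip) simp
  then show ?thesis by (simp only: *)
qed

lemma rfun_mult:
  assumes "rfun k A" "rfun k B"
  shows "rfun k (\<lambda>xs. A xs * B xs)"
proof -
  have "rfun 2 (\<lambda>xs. \<Sum>i<hd xs. hd (tl xs))"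
    by (intro rfun_sum rfun_var) simp_all
  then have "rfun 2 (\<lambda>xs. hd xs * hd (tl xs))" by simp
  from rfun_call2[OF this assms] show ?thesis .
qed

lemma rfun_prod:
  assumes "rfun k N" "rfun (Suc k) (\<lambda>ys. G (hd ys) (tl ys))"
  shows "rfun k (\<lambda>xs. \<Prod>i<N xs. G i xs)"
proof -
  have *: "rec_nat 1 (\<lambda>i y. y * g i) n = (\<Prod>i<n. g i)" for n and g :: "nat \<Rightarrow> nat"
    by (induction n) auto
  have "rfun k (\<lambda>xs. rec_nat 1 (\<lambda>i y. y * G i xs) (N xs))"
    by (intro rfun_rec_nat assms rfun_mult rfun_var rfun_const rfun_skip) simp
  then show ?thesis by (simp only: *)
qed

lemma rfun_power:
  assumes "rfun k A" "rfun k B"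
  shows "rfun k (\<lambda>xs. A xs ^ B xs)"
proof -
  have "rfun 2 (\<lambda>xs. \<Prod>i<hd (tl xs). hd xs)"
    by (intro rfun_prod rfun_var) simp_all
  then have "rfun 2 (\<lambda>xs. hd xs ^ hd (tl xs))" by simp
  from rfun_call2[OF this assms] show ?thesis .
qed

lemma rfun_fact:
  assumes "rfun k A"
  shows "rfun k (\<lambda>xs. fact (A xs))"
proof -
  have "rfun 1 (\<lambda>xs. \<Prod>i<hd xs. Suc i)"
    by (intro rfun_prod rfun_var rfun_Suc) simp_all
  then have "rfun 1 (\<lambda>xs. fact (hd xs))"
    by (simp add: fact_prod_Suc lessThan_atLeast0)
  from rfun_call1[OF this assms] show ?thesis .
qed

lemma rfun_diff:
  assumes "rfun k A" "rfun k B"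
  shows "rfun k (\<lambda>xs. A xs - B xs)"
proof -
  have pred: "rec_nat 0 (\<lambda>n y. n) a = a - 1" for a :: nat by (cases a) auto
  have "rfun 1 (\<lambda>xs. rec_nat 0 (\<lambda>n y. n) (hd xs))"
    by (intro rfun_rec_nat rfun_const rfun_var) simp_all
  then have p: "rfun 1 (\<lambda>xs. hd xs - 1)" by (simp only: pred)
  have *: "rec_nat a (\<lambda>n y. y - 1) b = a - b" for a b :: nat by (induction b) auto
  have "rfun k (\<lambda>xs. rec_nat (A xs) (\<lambda>n y. y - 1) (B xs))"
    by (intro rfun_rec_nat assms rfun_call1[OF p] rfun_var) simp
  then show ?thesis by (simp only: *)
qed

section \<open>Decidable predicates and bounded quantifiers\<close>

lemma rfun_of_bool: "rpred k P \<Longrightarrow> rfun k (\<lambda>xs. of_bool (P xs))"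
  by (simp add: rpred_def)

lemma of_bool_not_nat: "of_bool (\<not> P) = 1 - (of_bool P :: nat)"
  by simp

lemma rpred_not: "rpred k P \<Longrightarrow> rpred k (\<lambda>xs. \<not> P xs)"
  unfolding rpred_def by (simp only: of_bool_not_nat) (intro rfun_diff rfun_const)

lemma rpred_less:
  assumes "rfun k A" "rfun k B"
  shows "rpred k (\<lambda>xs. A xs < B xs)"
proof -
  have "of_bool (a < b) = 1 - (1 - (b - a))" for a b :: nat by auto
  then show ?thesis
    unfolding rpred_def by (simp only:) (intro rfun_diff rfun_const assms)
qed

lemma rpred_le: "rfun k A \<Longrightarrow> rfun k B \<Longrightarrow> rpred k (\<lambda>xs. A xs \<le> B xs)"
  unfolding not_less[symmetric] by (intro rpred_not rpred_less)

lemma rpred_conj: "rpred k P \<Longrightarrow> rpred k Q \<Longrightarrow> rpred k (\<lambda>xs. P xs \<and> Q xs)"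
  unfolding rpred_def of_bool_conj by (rule rfun_mult)

lemma rpred_eq: "rfun k A \<Longrightarrow> rfun k B \<Longrightarrow> rpred k (\<lambda>xs. A xs = B xs)"
  unfolding eq_iff by (intro rpred_conj rpred_le)

lemma rpred_ex:
  assumes "rfun k N" "rpred (Suc k) (\<lambda>ys. P (hd ys) (tl ys))"
  shows "rpred k (\<lambda>xs. \<exists>i<N xs. P i xs)"
proof -
  have "(\<exists>i<n. Q i) \<longleftrightarrow> 0 < (\<Sum>i<n. of_bool (Q i) :: nat)" for n :: nat and Q
    by (auto simp: sum_of_bool_eq card_gt_0_iff)
  then show ?thesis
    by (simp only:) (intro rpred_less rfun_const rfun_sum rfun_of_bool assms)
qed

lemma rpred_all:
  assumes "rfun k N" "rpred (Suc k) (\<lambda>ys. P (hd ys) (tl ys))"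
  shows "rpred k (\<lambda>xs. \<forall>i<N xs. P i xs)"
proof -
  have "(\<forall>i<n. Q i) \<longleftrightarrow> \<not> (\<exists>i<n. \<not> Q i)" for n :: nat and Q
    by auto
  then show ?thesis
    by (simp only:) (intro rpred_not rpred_ex assms)
qed

text \<open>The set is fixed rather than an input, so the quantifier unfolds into a finite
  conjunction inside the program. Forbidden patterns and their supports are hard-wired in this
  way.\<close>

lemma rpred_finite_all:
  assumes "finite S" "\<And>s. s \<in> S \<Longrightarrow> rpred k (P s)"
  shows "rpred k (\<lambda>xs. \<forall>s\<in>S. P s xs)"
  using assms
proof (induction S)
  case empty
  show ?case unfolding rpred_def by (simp add: rfun_const)
next
  case (insert s S)
  then show ?case by (simp add: rpred_conj)
qed

lemma rpred_finite_ex: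
  assumes "finite S" "\<And>s. s \<in> S \<Longrightarrow> rpred k (P s)"
  shows "rpred k (\<lambda>xs. \<exists>s\<in>S. P s xs)"
proof -
  have "rpred k (\<lambda>xs. \<not> (\<forall>s\<in>S. \<not> P s xs))"
    by (intro rpred_not rpred_finite_all assms)
  then show ?thesis by simp
qed

lemma rpred_call2:
  assumes "rpred 2 (\<lambda>xs. P (hd xs) (hd (tl xs)))" "rfun k A" "rfun k B"
  shows "rpred k (\<lambda>xs. P (A xs) (B xs))"
  using rfun_call2[of "\<lambda>x y. of_bool (P x y)"] assms unfolding rpred_def by blast

lemma rpred_call4:
  assumes "rpred 4 (\<lambda>xs. P (hd xs) (hd (tl xs)) (hd (tl (tl xs))) (hd (tl (tl (tl xs)))))"
    and "rfun k A" "rfun k B" "rfun k C" "rfun k D"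
  shows "rpred k (\<lambda>xs. P (A xs) (B xs) (C xs) (D xs))"
  using rfun_call4[of "\<lambda>x y z w. of_bool (P x y z w)"] assms unfolding rpred_def by blast

lemma rfun_div:
  assumes "rfun k A" "rfun k B"
  shows "rfun k (\<lambda>xs. A xs div B xs)"
proof -
  \<comment> \<open>The quotient is the number of positive multiples of b up to a. The guard makes
    the sum 0 for b = 0, in agreement with \<open>div\<close>.\<close>
  have *: "a div b = (\<Sum>i<a. of_bool (0 < b \<and> Suc i * b \<le> a))" for a b :: nat
  proof (cases "b = 0")
    case False
    then have "Suc i * b \<le> a \<longleftrightarrow> i < a div b" for i
      using less_eq_div_iff_mult_less_eq[of b "Suc i" a] by (simp add: Suc_le_eq)
    moreover have "i < a" if "i < a div b" for i
      using that div_le_dividend by (rule less_le_trans)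
    ultimately have "i < a \<and> Suc i * b \<le> a \<longleftrightarrow> i < a div b" for i
      by blast
    then have "{..<a} \<inter> {i. Suc i * b \<le> a} = {..<a div b}" by auto
    then show ?thesis using False by (simp add: sum_of_bool_eq del: mult_Suc)
  qed simp
  have "rfun k (\<lambda>xs. A xs div B xs) \<longleftrightarrow>
      rfun k (\<lambda>xs. (\<lambda>a b. \<Sum>i<a. of_bool (0 < b \<and> Suc i * b \<le> a)) (A xs) (B xs))"
    by (simp only: *)
  moreover have "\<dots>"
    by (rule rfun_call2[OF _ assms])
      (intro rfun_sum rfun_of_bool rpred_conj rpred_less rpred_le rfun_mult rfun_Suc
        rfun_var rfun_const; simp)
  ultimately show ?thesis by blast
qed

lemma rfun_mod:
  assumes "rfun k A" "rfun k B"
  shows "rfun k (\<lambda>xs. A xs mod B xs)"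
  unfolding minus_div_mult_eq_mod[symmetric] by (intro rfun_diff rfun_mult rfun_div assms)

lemmas rfun_intros = rfun_var rfun_const rfun_Suc rfun_add rfun_mult rfun_diff rfun_power rfun_fact
  rfun_div rfun_mod rfun_sum rfun_of_bool rpred_not rpred_conj rpred_less rpred_le rpred_eq
  rpred_ex rpred_all

text \<open>Counting positive exponents whose power of 2 stays below the argument avoids a search;
  the empty sum matches the value at 0.\<close>

lemma floor_log_eq_sum: "floor_log n = (\<Sum>i<n. of_bool (2 ^ Suc i \<le> n))"
proof (cases "n = 0")
  case False
  have "{..<n} \<inter> {i. 2 ^ Suc i \<le> n} = {..<floor_log n}"
  proof (intro equalityI subsetI)
    fix i assume "i \<in> {..<n} \<inter> {i. 2 ^ Suc i \<le> n}"
    then have "(2::nat) ^ Suc i \<le> n" by blast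
    also have "n < 2 ^ Suc (floor_log n)" using floor_log_exp2_gt[of n] by simp
    finally have "(2::nat) ^ Suc i < 2 ^ Suc (floor_log n)" .
    then show "i \<in> {..<floor_log n}"
      using power_less_imp_less_exp[of "2::nat" "Suc i" "Suc (floor_log n)"] by simp
  next
    fix i assume "i \<in> {..<floor_log n}"
    then have "(2::nat) ^ Suc i \<le> 2 ^ floor_log n" by (intro power_increasing) auto
    then have "2 ^ Suc i \<le> n" using floor_log_exp2_le[of n] False by linarith
    moreover have "i < 2 ^ Suc i"
      using less_exp[of "Suc i"] by linarith
    ultimately show "i \<in> {..<n} \<inter> {i. 2 ^ Suc i \<le> n}"
      by (simp del: power_Suc)
  qed
  then show ?thesis by (simp add: sum_of_bool_eq)
qed (simp add: floor_log_rec)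

lemma rfun_floor_log:
  assumes "rfun k A"
  shows "rfun k (\<lambda>xs. floor_log (A xs))"
proof (rule rfun_call1[OF _ assms])
  show "rfun 1 (\<lambda>xs. floor_log (hd xs))"
    unfolding floor_log_eq_sum by (intro rfun_intros; simp)
qed

lemma rfun_prod_encode:
  "rfun k A \<Longrightarrow> rfun k B \<Longrightarrow> rfun k (\<lambda>xs. prod_encode (A xs, B xs))"
  unfolding prod_encode_def triangle_def by (simp add: rfun_intros)

lemma rfun_1_imp_computable_fun:
  assumes "rfun 1 (\<lambda>xs. g (hd xs))"
  shows "computable_fun g"
proof -
  obtain r where "\<And>xs. length xs = 1 \<Longrightarrow> computes r xs (g (hd xs))"
    using assms unfolding rfun_def by blast
  then have "computes r [n] (g n)" for n by (metis length_Cons list.size(3) One_nat_def list.sel(1))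
  then show ?thesis unfolding computable_fun_def by blast
qed

text \<open>\<open>int_encode\<close> sends a nonnegative k to 2k, which explains the doubled
  numerator and denominator. Since the code of an integer n is at least n, precision measured by the
  code suffices for every n, negative ones included, and the program never decodes its
  input.\<close>

lemma computable_realI:
  assumes "computable_fun (\<lambda>z. prod_encode (2 * p z, 2 * q z))"
    and "\<And>z. 0 < q z" "\<And>z. \<bar>x - real (p z) / real (q z)\<bar> \<le> (1 / 2) ^ z"
  shows "computable_real x"
  unfolding computable_real_def
proof (intro exI conjI allI)
  show "computable_fun (\<lambda>z. prod_encode (2 * p z, 2 * q z))" by (rule assms(1))
  fix n :: int
  define z where "z = int_encode n"
  have "int_decode (2 * k) = int k" for k
    using int_encode_inverse[of "int k"] by (simp add: int_encode_def sum_encode_def)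
  then have "real_of_rat (nat_to_rat_surj (prod_encode (2 * p z, 2 * q z)))
      = of_rat (Fract (int (p z)) (int (q z)))"
    by (simp add: nat_to_rat_surj_def)
  also have "\<dots> = real (p z) / real (q z)" using assms(2)[of z] by (simp add: of_rat_rat)
  finally have "\<bar>x - of_rat (nat_to_rat_surj (prod_encode (2 * p z, 2 * q z)))\<bar> \<le> (1 / 2) ^ z"
    using assms(3) by simp
  also have "(1 / 2 :: real) ^ z = 2 powi (- int z)"
    by (simp add: power_int_minus power_one_over field_simps)
  also have "\<dots> \<le> 2 powi (- n)"
  proof (rule power_int_increasing)
    show "- int z \<le> - n" unfolding z_def int_encode_def sum_encode_def by simp
  qed simp
  finally show "\<bar>x - of_rat (nat_to_rat_surj (prod_encode (2 * p (int_encode n), 2 * q (int_encode n))))\<bar>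
      \<le> 2 powi (- n)"
    unfolding z_def .
qed

section \<open>Digits\<close>

definition digit :: "nat \<Rightarrow> nat \<Rightarrow> nat \<Rightarrow> nat" where
  "digit a c i = c div a ^ i mod a"

lemma digit_0: "digit a c 0 = c mod a"
  by (simp add: digit_def)

lemma digit_Suc: "digit a c (Suc i) = digit a (c div a) i"
  by (simp add: digit_def div_mult2_eq)

lemma digit_less: "0 < a \<Longrightarrow> digit a c i < a"
  by (simp add: digit_def)

text \<open>With \<open>digits_inj\<close>, this identifies words of length k over a letters with
  the numbers below \<open>a ^ k\<close>, so that quantifying over finite configurations becomes
  bounded quantification over numbers.\<close>

lemma ex_digits:
  assumes "\<And>i. i < k \<Longrightarrow> \<phi> i < a"
  shows "\<exists>d < a ^ k. \<forall>i<k. digit a d i = \<phi> i"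
  using assms
proof (induction k arbitrary: \<phi>)
  case 0
  then show ?case by simp
next
  case (Suc k)
  obtain d where d: "d < a ^ k" "\<And>i. i < k \<Longrightarrow> digit a d i = \<phi> (Suc i)"
    using Suc.IH[of "\<lambda>i. \<phi> (Suc i)"] Suc.prems by auto
  have a: "\<phi> 0 < a" using Suc.prems by simp
  have "\<phi> 0 + a * d < a * Suc d" using a by simp
  also have "\<dots> \<le> a * a ^ k" using d(1) by (intro mult_le_mono2) simp
  finally have "\<phi> 0 + a * d < a ^ Suc k" by simp
  moreover have "digit a (\<phi> 0 + a * d) i = \<phi> i" if "i < Suc k" for i
    using that a d(2) by (cases i) (auto simp: digit_0 digit_Suc)
  ultimately show ?case by blast
qed

lemma digits_inj:
  assumes "c < a ^ k" "d < a ^ k" "\<And>i. i < k \<Longrightarrow> digit a c i = digit a d i"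
  shows "c = d"
  using assms
proof (induction k arbitrary: c d)
  case 0
  then show ?case by simp
next
  case (Suc k)
  have "c div a = d div a"
  proof (rule Suc.IH)
    show "c div a < a ^ k" "d div a < a ^ k"
      using Suc.prems(1,2) by (simp_all add: less_mult_imp_div_less mult.commute)
    show "digit a (c div a) i = digit a (d div a) i" if "i < k" for i
      using Suc.prems(3)[of "Suc i"] that by (simp add: digit_Suc)
  qed
  moreover have "c mod a = d mod a"
    using Suc.prems(3)[of 0] by (simp add: digit_0)
  ultimately have "c div a * a + c mod a = d div a * a + d mod a" by (simp only:)
  then show ?case by (simp only: div_mult_mod_eq)
qed

lemma ex_digits2:
  assumes "\<And>i j. i < n \<Longrightarrow> j < n \<Longrightarrow> \<phi> i j < a"
  shows "\<exists>d < a ^ (n * n). \<forall>i<n. \<forall>j<n. digit a d (i * n + j) = \<phi> i j"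
proof -
  have "\<exists>d < a ^ (n * n). \<forall>l < n * n. digit a d l = \<phi> (l div n) (l mod n)"
  proof (rule ex_digits)
    fix l assume l: "l < n * n"
    then have "0 < n" by (cases n) auto
    then show "\<phi> (l div n) (l mod n) < a"
      using l by (intro assms) (simp_all add: less_mult_imp_div_less)
  qed
  then obtain d where d: "d < a ^ (n * n)" "\<And>l. l < n * n \<Longrightarrow> digit a d l = \<phi> (l div n) (l mod n)"
    by blast
  have "digit a d (i * n + j) = \<phi> i j" if "i < n" "j < n" for i j
  proof -
    have "i * n + j < Suc i * n" using that by simp
    also have "\<dots> \<le> n * n" using that by (intro mult_le_mono1) simp
    finally show ?thesis using that d(2) by simp
  qed
  with d(1) show ?thesis by blast
qed

lemma digits2_inj:
  assumes "c < a ^ (n * n)" "d < a ^ (n * n)"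
    and "\<And>i j. i < n \<Longrightarrow> j < n \<Longrightarrow> digit a c (i * n + j) = digit a d (i * n + j)"
  shows "c = d"
  using assms(1,2)
proof (rule digits_inj)
  fix l assume l: "l < n * n"
  then have "0 < n" by (cases n) auto
  then have "l div n < n" "l mod n < n"
    using l by (simp_all add: less_mult_imp_div_less)
  from assms(3)[OF this] show "digit a c l = digit a d l" by simp
qed

lemma rfun_digit:
  assumes "rfun k A" "rfun k B" "rfun k C"
  shows "rfun k (\<lambda>xs. digit (A xs) (B xs) (C xs))"
  unfolding digit_def by (intro rfun_intros assms)

section \<open>Gluing and periodic configurations\<close>

lemma subshift_translate:
  assumes "subshift X" "x \<in> X"
  shows "(\<lambda>(i, j). x (a + i, b + j)) \<in> X"
proof -
  have "shift (a, b) x \<in> X" using assms unfolding subshift_def by blast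
  moreover have "shift (a, b) x = (\<lambda>(i, j). x (a + i, b + j))"
    by (auto simp: shift_def fun_eq_iff)
  ultimately show ?thesis by simp
qed

definition block :: "nat \<Rightarrow> 'a config \<Rightarrow> 'a pattern" where
  "block n x = (\<lambda>v. if v \<in> square n then Some (x v) else None)"

lemma dom_block [simp]: "dom (block n x) = square n"
  by (auto simp: block_def dom_def)

lemma occurs_at_block:
  "occurs_at (block n y) (s, t) x \<longleftrightarrow>
     (\<forall>i j. 0 \<le> i \<and> i < int n \<and> 0 \<le> j \<and> j < int n \<longrightarrow> x (s + i, t + j) = y (i, j))"
  unfolding occurs_at_def dom_block by (auto simp: square_def block_def)

lemma block_eq_iff:
  "block n x = block n y \<longleftrightarrow>
     (\<forall>i j. 0 \<le> i \<and> i < int n \<and> 0 \<le> j \<and> j < int n \<longrightarrow> x (i, j) = y (i, j))"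
  by (auto simp: fun_eq_iff square_def block_def)

lemma block_in_language: "x \<in> X \<Longrightarrow> block n x \<in> language n X"
  unfolding language_def appears_in_def
  by (auto intro!: bexI[of _ x] exI[of _ 0] simp: zero_prod_def occurs_at_block)

text \<open>Shift invariance moves any occurrence to the origin.\<close>

lemma language_eq_blocks:
  assumes "subshift X"
  shows "language n X = block n ` X"
proof (intro equalityI subsetI)
  fix p assume "p \<in> language n X"
  then obtain x s t where x: "x \<in> X" "dom p = square n" "occurs_at p (s, t) x"
    unfolding language_def appears_in_def by auto
  have "p v = block n (\<lambda>(i, j). x (s + i, t + j)) v" for v
    using x(2,3) by (cases "v \<in> square n") (auto simp: occurs_at_def block_def split: prod.splits)
  then have "p = block n (\<lambda>(i, j). x (s + i, t + j))" ..
  then show "p \<in> block n ` X" using subshift_translate[OF assms x(1)] by blast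
qed (auto intro: block_in_language)

text \<open>Gluing with absolute positions: both squares are moved to the origin, glued with
  relative displacement, and the result is moved back. Later constructions can then keep one fixed
  coordinate system.\<close>

lemma glue:
  assumes "subshift X" "block_gluing f X" "x \<in> X" "y \<in> X"
    and "int (m + f m) \<le> max \<bar>c - a\<bar> \<bar>d - b\<bar>"
  obtains z where "z \<in> X"
    "\<And>i j. a \<le> i \<Longrightarrow> i < a + int m \<Longrightarrow> b \<le> j \<Longrightarrow> j < b + int m \<Longrightarrow> z (i, j) = x (i, j)"
    "\<And>i j. c \<le> i \<Longrightarrow> i < c + int m \<Longrightarrow> d \<le> j \<Longrightarrow> j < d + int m \<Longrightarrow> z (i, j) = y (i, j)"
proof -
  let ?x = "\<lambda>(i, j). x (a + i, b + j)" and ?y = "\<lambda>(i, j). y (c + i, d + j)"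
  have "block m ?x \<in> language m X" "block m ?y \<in> language m X"
    by (intro block_in_language subshift_translate assms)+
  then have "(c - a, d - b) \<in> gluing_set X (block m ?y) (block m ?x)"
    using assms(2,5) unfolding block_gluing_def sup_norm_def by simp
  then obtain w where w: "w \<in> X" "occurs_at (block m ?x) 0 w"
      "occurs_at (block m ?y) (c - a, d - b) w"
    unfolding gluing_set_def by blast
  have w1: "w (i, j) = x (a + i, b + j)" if "0 \<le> i" "i < int m" "0 \<le> j" "j < int m" for i j
    using w(2) that by (auto simp: zero_prod_def occurs_at_block)
  have w2: "w (c - a + i, d - b + j) = y (c + i, d + j)"
    if "0 \<le> i" "i < int m" "0 \<le> j" "j < int m" for i j
    using w(3) that by (auto simp: occurs_at_block)
  show thesis
  proof (rule that)
    show "(\<lambda>(i, j). w (- a + i, - b + j)) \<in> X"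
      by (rule subshift_translate[OF assms(1) w(1)])
    show "(case (i, j) of (i, j) \<Rightarrow> w (- a + i, - b + j)) = x (i, j)"
      if "a \<le> i" "i < a + int m" "b \<le> j" "j < b + int m" for i j
      using w1[of "i - a" "j - b"] that by simp
    show "(case (i, j) of (i, j) \<Rightarrow> w (- a + i, - b + j)) = y (i, j)"
      if "c \<le> i" "i < c + int m" "d \<le> j" "j < d + int m" for i j
      using w2[of "i - c" "j - d"] that by simp
  qed
qed

text \<open>A form of finite type that does not mention patterns: membership is tested on windows of
  one size, which may come from different configurations and positions. This suits
  \<open>periodize\<close>, where windows are matched with windows elsewhere.\<close>

definition window_determined :: "nat \<Rightarrow> 'a config set \<Rightarrow> bool" where
  "window_determined r X \<longleftrightarrow>
     (\<forall>x. (\<forall>i j. \<exists>y\<in>X. \<exists>i' j'. \<forall>s t. 0 \<le> s \<and> s < int r \<and> 0 \<le> t \<and> t < int r \<longrightarrow>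
        x (i + s, j + t) = y (i' + s, j' + t)) \<longrightarrow> x \<in> X)"

lemma finite_patterns_bounded:
  fixes F :: "'a pattern set"
  assumes "finite F" "\<forall>p\<in>F. finite (dom p)"
  obtains R :: nat where
    "\<forall>p\<in>F. \<forall>v\<in>dom p. sup_norm v \<le> int R"
proof -
  let ?S = "(\<lambda>(a, b). nat \<bar>a\<bar> + nat \<bar>b\<bar>) ` (\<Union>p\<in>F. dom p)"
  have "finite ?S" using assms by blast
  then obtain R where R: "\<forall>s\<in>?S. s \<le> R" using finite_nat_set_iff_bounded_le by metis
  have "\<bar>a\<bar> \<le> int R \<and> \<bar>b\<bar> \<le> int R" if "p \<in> F" "(a, b) \<in> dom p" for p a b
  proof -
    have "nat \<bar>a\<bar> + nat \<bar>b\<bar> \<in> ?S" using that by force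
    then have "nat \<bar>a\<bar> + nat \<bar>b\<bar> \<le> R" using R by blast
    then show ?thesis by linarith
  qed
  then have "\<forall>p\<in>F. \<forall>v\<in>dom p. sup_norm v \<le> int R" by (fastforce simp: sup_norm_def)
  then show thesis by (rule that)
qed

text \<open>A window of side 2R + 1 covers every support, since supports lie in [-R, R] in both
  coordinates. A forbidden pattern in x would thus be copied into a configuration of X.\<close>

lemma finite_type_window_determined:
  assumes "finite_type X"
  obtains r where "0 < r" "window_determined r X"
proof -
  obtain F where F: "finite F" "\<forall>p\<in>F. finite (dom p)" "X = {x. \<forall>p\<in>F. \<not> appears_in p x}"
    using assms unfolding finite_type_def by blast
  obtain R where R: "\<forall>p\<in>F. \<forall>v\<in>dom p. sup_norm v \<le> int R"
    using finite_patterns_bounded[OF F(1,2)] by blast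
  have "x \<in> X" if x: "\<And>i j. \<exists>y\<in>X. \<exists>i' j'. \<forall>s t. 0 \<le> s \<and> s < int (2 * R + 1) \<and> 0 \<le> t \<and>
      t < int (2 * R + 1) \<longrightarrow> x (i + s, j + t) = y (i' + s, j' + t)" for x
  proof (rule ccontr)
    assume "x \<notin> X"
    then obtain p i j where p: "p \<in> F" "occurs_at p (i, j) x"
      using F(3) unfolding appears_in_def by auto
    obtain y i' j' where y: "y \<in> X" "\<And>s t. 0 \<le> s \<and> s < int (2 * R + 1) \<and> 0 \<le> t \<and>
      t < int (2 * R + 1) \<Longrightarrow> x (i - int R + s, j - int R + t) = y (i' + s, j' + t)"
      using x[of "i - int R" "j - int R"] by blast
    have "occurs_at p (i' + int R, j' + int R) y"
      unfolding occurs_at_def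
    proof
      fix v assume v: "v \<in> dom p"
      obtain a b where ab: "v = (a, b)" by (cases v)
      have "p v = Some (x ((i, j) + v))" using p(2) v unfolding occurs_at_def by blast
      moreover have "x (i + a, j + b) = y (i' + int R + a, j' + int R + b)"
        using y(2)[of "a + int R" "b + int R"] R[rule_format, OF p(1) v] ab
        by (simp add: sup_norm_def abs_le_iff algebra_simps)
      ultimately show "p v = Some (y ((i' + int R, j' + int R) + v))" by (simp add: ab)
    qed
    then show False using y(1) F(3) p(1) unfolding appears_in_def by blast
  qed
  then have "window_determined (2 * R + 1) X" unfolding window_determined_def by blast
  then show thesis using that[of "2 * R + 1"] by simp
qed

text \<open>A repetition of period \<open>(P, H)\<close> in \<open>y\<close> along an L-shaped strip of width \<open>r\<close> already makes
  every window of the periodised configuration a window of \<open>y\<close>.\<close>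

lemma periodize:
  fixes P H :: int
  assumes "window_determined r X" "y \<in> X" "0 < r" "int r \<le> P" "int r \<le> H"
    and horizontal: "\<And>i j. 0 \<le> i \<Longrightarrow> i < int r \<Longrightarrow> 0 \<le> j \<Longrightarrow> j < H \<Longrightarrow> y (P + i, j) = y (i, j)"
    and vertical: "\<And>i j. 0 \<le> i \<Longrightarrow> i < P + int r \<Longrightarrow> 0 \<le> j \<Longrightarrow> j < int r \<Longrightarrow>
      y (i, H + j) = y (i, j)"
  shows "(\<lambda>(i, j). y (i mod P, j mod H)) \<in> X"
proof -
  \<comment> \<open>As s is below r and r is at most the period, a window wraps around at most once
    in each direction.\<close>
  have mod_split: "(i + s) mod M = (if i mod M + s < M then i mod M + s else i mod M + s - M)"
    if "0 \<le> s" "s < int r" "int r \<le> M" for i s M :: int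
  proof -
    have M: "0 < M" using that assms(3) by linarith
    then have b: "0 \<le> i mod M" "i mod M < M" by simp_all
    have "(i + s) mod M = (i mod M + s) mod M" by (simp add: mod_add_left_eq)
    also have "\<dots> = (if i mod M + s < M then i mod M + s else i mod M + s - M)"
    proof (cases "i mod M + s < M")
      case False
      have "(i mod M + s) mod M = (i mod M + s - M) mod M" by simp
      also have "\<dots> = i mod M + s - M"
      proof (rule mod_pos_pos_trivial)
        show "0 \<le> i mod M + s - M" "i mod M + s - M < M" using False b that by linarith+
      qed
      finally show ?thesis using False by simp
    qed (use b that in auto)
    finally show ?thesis .
  qed
  have *: "(case (i + s, j + t) of (i, j) \<Rightarrow> y (i mod P, j mod H)) = y (i mod P + s, j mod H + t)"
    if st: "0 \<le> s" "s < int r" "0 \<le> t" "t < int r" for i j s t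
  proof -
    have PH: "0 < P" "0 < H" using assms(3-5) by linarith+
    then have b: "0 \<le> i mod P" "i mod P < P" "0 \<le> j mod H" "j mod H < H" by simp_all
    \<comment> \<open>The horizontal wrap is undone first, with the second coordinate already
      reduced below H. Afterwards the first coordinate may reach up to P + r; this is why the two
      repetition hypotheses have different ranges.\<close>
    have "y ((i + s) mod P, (j + t) mod H) = y (i mod P + s, (j + t) mod H)"
      using mod_split[of s P i] horizontal[of "i mod P + s - P" "(j + t) mod H"] st b PH assms(4)
      by (auto split: if_splits)
    also have "\<dots> = y (i mod P + s, j mod H + t)"
      using mod_split[of t H j] vertical[of "i mod P + s" "j mod H + t - H"] st b PH assms(5)
      by (auto split: if_splits)
    finally show ?thesis by simp
  qed
  have "\<forall>i j. \<exists>w\<in>X. \<exists>i' j'. \<forall>s t. 0 \<le> s \<and> s < int r \<and> 0 \<le> t \<and> t < int r \<longrightarrow>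
      (case (i + s, j + t) of (i, j) \<Rightarrow> y (i mod P, j mod H)) = w (i' + s, j' + t)"
    using * assms(2) by blast
  then show ?thesis
    by (rule assms(1)[unfolded window_determined_def, THEN spec, THEN mp])
qed

text \<open>The existing row lies in a square of side m, which is glued to a second m-square
  starting with one more copy. By monotonicity the gap G, admissible for side N, is admissible at
  every earlier stage, so all copies have the same spacing.\<close>

lemma row_of_copies:
  assumes "subshift X" "block_gluing f X" "mono f" "x \<in> X"
    and "f N \<le> G" "n + k * (n + G) \<le> N"
  shows "\<exists>y\<in>X. \<forall>l\<le>k. \<forall>i j. 0 \<le> i \<and> i < int n \<and> 0 \<le> j \<and> j < int n \<longrightarrow>
    y (int (l * (n + G)) + i, j) = x (i, j)"
  using assms(6)
proof (induction k)
  case 0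
  then show ?case using assms(4) by auto
next
  case (Suc k)
  define m where "m = n + k * (n + G)"
  obtain y where y: "y \<in> X" "\<And>l i j. l \<le> k \<Longrightarrow> 0 \<le> i \<Longrightarrow> i < int n \<Longrightarrow> 0 \<le> j \<Longrightarrow> j < int n \<Longrightarrow>
      y (int (l * (n + G)) + i, j) = x (i, j)"
    using Suc by auto
  define c where "c = int (Suc k * (n + G))"
  have nm: "n \<le> m" by (simp add: m_def)
  have c: "c = int (m + G)" by (simp add: c_def m_def)
  have "f m \<le> G" using monoD[OF assms(3), of m N] assms(5) Suc.prems by (simp add: m_def)
  then obtain z where z: "z \<in> X"
    "\<And>i j. 0 \<le> i \<Longrightarrow> i < 0 + int m \<Longrightarrow> 0 \<le> j \<Longrightarrow> j < 0 + int m \<Longrightarrow> z (i, j) = y (i, j)"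
    "\<And>i j. c \<le> i \<Longrightarrow> i < c + int m \<Longrightarrow> 0 \<le> j \<Longrightarrow> j < 0 + int m \<Longrightarrow>
      z (i, j) = (\<lambda>(i, j). x (- c + i, 0 + j)) (i, j)"
    using glue[OF assms(1,2) y(1) subshift_translate[OF assms(1,4), of "- c" 0], of m c 0 0 0] c
    by auto
  have "z (int (l * (n + G)) + i, j) = x (i, j)"
    if l: "l \<le> Suc k" and ij: "0 \<le> i" "i < int n" "0 \<le> j" "j < int n" for l i j
  proof (cases "l = Suc k")
    case True
    have "z (c + i, j) = x (i, j)" using z(3)[of "c + i" j] ij nm by auto
    then show ?thesis by (simp only: True c_def)
  next
    case False
    then have lk: "l \<le> k" using l by simp
    then have "l * (n + G) \<le> k * (n + G)" by (rule mult_le_mono1)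
    then have "int (l * (n + G)) + i < int m" using ij unfolding m_def by linarith
    then show ?thesis using z(2)[of "int (l * (n + G)) + i" j] y(2)[OF lk] ij nm by auto
  qed
  then show ?case using z(1) by blast
qed

text \<open>Many copies of the block are glued in a row of length \<open>N\<close>, and this row is glued to a copy of
  itself at height \<open>D\<close>. The columns of height \<open>D\<close> and width \<open>r\<close> at the starts of the copies take at
  most \<open>k\<close> values, so two of the \<open>k + 1\<close> columns agree.\<close>

lemma periodic_extension:
  fixes X :: "('a::finite) config set" and n r :: nat
  defines "k \<equiv> card (UNIV :: 'a set) ^ (r * (2 * n))"
  defines "N \<equiv> n + k * (2 * n)"
  assumes "subshift X" "block_gluing f X" "mono f" "window_determined r X" "0 < r" "r \<le> n"
    and "f N \<le> n" "x \<in> X"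
  shows "\<exists>y\<in>X. block n y = block n x \<and>
    (\<forall>i j. y (i + int (fact N), j) = y (i, j) \<and> y (i, j + int (fact N)) = y (i, j))"
proof -
  \<comment> \<open>D is both the spacing of the copies (block n plus gap n) and the vertical
    period.\<close>
  define D where "D = 2 * n"
  have D: "n + n = D" "0 < D" using assms(7,8) by (auto simp: D_def)
  obtain y where y: "y \<in> X" "\<And>l i j. l \<le> k \<Longrightarrow> 0 \<le> i \<Longrightarrow> i < int n \<Longrightarrow> 0 \<le> j \<Longrightarrow> j < int n \<Longrightarrow>
      y (int (l * D) + i, j) = x (i, j)"
    using row_of_copies[OF assms(3-5,10), of N n n k] assms(9) unfolding N_def D D_def by auto
  \<comment> \<open>Gluing needs squares, so the lower N-square hangs down from the row: its top n
    lines are at heights 0 to n - 1. The upper one starts at height D, and the displacement is D + N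
    - n = N + n, hence at least N + f(N).\<close>
  obtain z where z: "z \<in> X"
    "\<And>i j. 0 \<le> i \<Longrightarrow> i < 0 + int N \<Longrightarrow> int n - int N \<le> j \<Longrightarrow> j < int n - int N + int N \<Longrightarrow>
      z (i, j) = y (i, j)"
    "\<And>i j. 0 \<le> i \<Longrightarrow> i < 0 + int N \<Longrightarrow> int D \<le> j \<Longrightarrow> j < int D + int N \<Longrightarrow>
      z (i, j) = (\<lambda>(i, j). y (0 + i, - int D + j)) (i, j)"
    using glue[OF assms(3,4) y(1) subshift_translate[OF assms(3) y(1), of 0 "- int D"],
        of N 0 0 "int D" "int n - int N"] assms(9) D by auto
  have nN: "n \<le> N" by (simp add: N_def)
  have zy: "z (i, j) = y (i, j)" if "0 \<le> i" "i < int N" "0 \<le> j" "j < int n" for i j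
    using z(2)[of i j] that nN by auto
  have zD: "z (i, int D + j) = z (i, j)" if "0 \<le> i" "i < int N" "0 \<le> j" "j < int n" for i j
    using z(3)[of i "int D + j"] zy[of i j] that nN by auto
  \<comment> \<open>\<open>restrict\<close> makes equality of two values mean agreement on the
    r-by-D column alone; there are exactly k such restricted functions.\<close>
  define S where "S = (\<lambda>l::nat. restrict (\<lambda>(s, t). z (int (l * D) + int s, int t)) ({..<r} \<times> {..<D}))"
  have "S ` {..k} \<subseteq> ({..<r} \<times> {..<D}) \<rightarrow>\<^sub>E UNIV"
    by (auto simp: S_def split: if_splits)
  then have "card (S ` {..k}) \<le> card (({..<r} \<times> {..<D}) \<rightarrow>\<^sub>E (UNIV::'a set))"
    by (intro card_mono finite_PiE) auto
  also have "\<dots> = k" by (simp add: card_PiE k_def D_def)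
  finally have "\<not> inj_on S {..k}" by (intro pigeonhole) simp
  then obtain l l' where l: "l < l'" "l' \<le> k" "S l = S l'"
    unfolding inj_on_def by (metis atMost_iff linorder_neqE_nat)
  define P where "P = int ((l' - l) * D)"
  have DP: "int D \<le> P"
  proof -
    have "1 * D \<le> (l' - l) * D" using l(1) by (intro mult_le_mono1) simp
    then show ?thesis unfolding P_def by (simp only: of_nat_le_iff mult_1)
  qed
  have PN: "P + int n \<le> int N"
  proof -
    have "(l' - l) * D \<le> k * D" using l by (intro mult_le_mono1) simp
    then have "(l' - l) * D + n \<le> N" unfolding N_def D_def by linarith
    then show ?thesis unfolding P_def by linarith
  qed
  have lP: "int (l * D) + P = int (l' * D)"
    using l(1) by (simp add: P_def algebra_simps of_nat_diff)
  have l'N: "int (l' * D) + int n \<le> int N"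
  proof -
    have "l' * D \<le> k * D" using l by (intro mult_le_mono1) simp
    then have "l' * D + n \<le> N" unfolding N_def D_def by linarith
    then show ?thesis by linarith
  qed
  \<comment> \<open>Moves copy l to the origin. The block then lies in one fundamental domain,
    because n is at most D and D at most P.\<close>
  define w where "w = (\<lambda>(i, j). z (int (l * D) + i, 0 + j))"
  have w: "w \<in> X" unfolding w_def by (rule subshift_translate[OF assms(3) z(1)])
  have per: "(\<lambda>(i, j). w (i mod P, j mod int D)) \<in> X"
  proof (rule periodize[OF assms(6) w assms(7)])
    show "int r \<le> P" "int r \<le> int D" using DP assms(8) D by linarith+
  next
    fix i j assume ij: "0 \<le> i" "i < int r" "0 \<le> j" "j < int D"
    have "S l (nat i, nat j) = S l' (nat i, nat j)" using l(3) by simp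
    then show "w (P + i, j) = w (i, j)"
      using ij by (simp add: S_def w_def nat_less_iff add.assoc[symmetric] lP[unfolded of_nat_mult])
  next
    fix i j assume ij: "0 \<le> i" "i < P + int r" "0 \<le> j" "j < int r"
    then show "w (i, int D + j) = w (i, j)"
      using zD[of "int (l * D) + i" j] l'N lP assms(8) by (simp add: w_def)
  qed
  have "block n (\<lambda>(i, j). w (i mod P, j mod int D)) = block n x"
    unfolding block_eq_iff
  proof (intro allI impI)
    fix i j assume ij: "0 \<le> i \<and> i < int n \<and> 0 \<le> j \<and> j < int n"
    then have "i mod P = i" "j mod int D = j"
      using DP D(1) by (auto intro!: mod_pos_pos_trivial)
    moreover have "w (i, j) = x (i, j)"
      using zy[of "int (l * D) + i" j] y(2)[of l i j] ij l l'N lP DP by (simp add: w_def)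
    ultimately show "(case (i, j) of (i, j) \<Rightarrow> w (i mod P, j mod int D)) = x (i, j)" by simp
  qed
  \<comment> \<open>Both periods are at most N, hence divide its factorial, independently of the
    chosen pair of copies.\<close>
  moreover have "P dvd int (fact N)" "int D dvd int (fact N)"
  proof -
    have "D \<le> (l' - l) * D" using DP unfolding P_def by (simp only: of_nat_le_iff)
    moreover have "(l' - l) * D \<le> N" using PN unfolding P_def by linarith
    moreover from calculation have "D \<le> N" by (rule order_trans)
    moreover have "1 \<le> D" using D(2) by simp
    moreover from calculation have "1 \<le> (l' - l) * D" by linarith
    ultimately have "(l' - l) * D dvd fact N" "D dvd fact N"
      by (simp_all only: dvd_fact)
    then show "P dvd int (fact N)" "int D dvd int (fact N)"
      unfolding P_def by (simp_all only: of_nat_dvd_iff)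
  qed
  then have "(i + int (fact N)) mod P = i mod P" "(j + int (fact N)) mod int D = j mod int D" for i j
    by (metis mod_add_right_eq add_0_right dvd_imp_mod_0)+
  ultimately show ?thesis using per by (intro bexI[OF _ per]) auto
qed

section \<open>Entropy bounds\<close>

lemma finite_language:
  fixes X :: "('a::finite) config set"
  shows "finite (language n X)"
proof -
  have "finite {p :: 'a pattern. dom p = square n \<and> ran p \<subseteq> UNIV}"
    by (rule finite_set_of_finite_maps) (auto simp: square_def)
  then show ?thesis by (rule rev_finite_subset) (auto simp: language_def)
qed

lemma card_language_pos:
  fixes X :: "('a::finite) config set"
  assumes "subshift X"
  shows "1 \<le> card (language n X)"
proof -
  have "language n X \<noteq> {}"
    using assms unfolding language_eq_blocks[OF assms] subshift_def by blast
  then show ?thesis using finite_language[of n X] by (simp add: Suc_le_eq card_gt_0_iff)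
qed

text \<open>A block is determined by the q * q tiles that cover it. Tiles may stick out of the
  block, so they are read off a chosen configuration extending it.\<close>

lemma card_language_tiling:
  fixes X :: "('a::finite) config set"
  assumes "subshift X" "M \<le> q * n"
  shows "card (language M X) \<le> card (language n X) ^ (q * q)"
proof -
  define rep where "rep = (\<lambda>p. SOME x. x \<in> X \<and> block M x = p)"
  have rep: "rep p \<in> X" "block M (rep p) = p" if "p \<in> language M X" for p
  proof -
    have "\<exists>x. x \<in> X \<and> block M x = p"
      using that unfolding language_eq_blocks[OF assms(1)] by blast
    from someI_ex[OF this] show "rep p \<in> X" "block M (rep p) = p" unfolding rep_def by blast+
  qed
  define tiles where "tiles = (\<lambda>p. \<lambda>(s, t) \<in> {..<q} \<times> {..<q}.
      block n (\<lambda>(i, j). rep p (int (s * n) + i, int (t * n) + j)))"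
  have "inj_on tiles (language M X)"
  proof (rule inj_onI)
    fix p p' assume p: "p \<in> language M X" "p' \<in> language M X" "tiles p = tiles p'"
    have "rep p (i, j) = rep p' (i, j)" if ij: "0 \<le> i" "i < int M" "0 \<le> j" "j < int M" for i j
    proof -
      define s t where "s = nat i div n" and "t = nat j div n"
      have "nat i < q * n" "nat j < q * n" using ij assms(2) by linarith+
      then have st: "s < q" "t < q"
        unfolding s_def t_def by (simp_all add: less_mult_imp_div_less)
      have n: "0 < n" using \<open>nat i < q * n\<close> by (cases n) auto
      have split: "i = int (s * n) + int (nat i mod n)" "j = int (t * n) + int (nat j mod n)"
        using ij unfolding s_def t_def of_nat_add[symmetric] by simp_all
      have "tiles p (s, t) = tiles p' (s, t)" using p(3) by simp
      then have "block n (\<lambda>(i, j). rep p (int (s * n) + i, int (t * n) + j))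
          = block n (\<lambda>(i, j). rep p' (int (s * n) + i, int (t * n) + j))"
        using st by (simp add: tiles_def)
      then have "rep p (int (s * n) + int (nat i mod n), int (t * n) + int (nat j mod n))
          = rep p' (int (s * n) + int (nat i mod n), int (t * n) + int (nat j mod n))"
        unfolding block_eq_iff using n by simp
      then show ?thesis using split by simp
    qed
    then have "block M (rep p) = block M (rep p')" by (simp add: block_eq_iff)
    then show "p = p'" using rep(2) p(1,2) by metis
  qed
  moreover have "tiles ` language M X \<subseteq> ({..<q} \<times> {..<q}) \<rightarrow>\<^sub>E language n X"
    using rep(1) by (auto simp: tiles_def intro!: block_in_language subshift_translate[OF assms(1)]
        split: if_splits)
  ultimately have "card (language M X) \<le> card (({..<q} \<times> {..<q}) \<rightarrow>\<^sub>E language n X)"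
    by (rule card_inj_on_le) (intro finite_PiE finite_language; simp)
  then show ?thesis by (simp add: card_PiE)
qed

text \<open>The blocks are glued in pairs, then the two pairs are glued. All squares involved have
  side at most 3 m, so the single gap f(3 m) serves both rounds and keeps the arrangement
  square.\<close>

lemma glue_four:
  assumes "subshift X" "block_gluing f X" "mono f" "f (3 * m) \<le> m"
    and "x1 \<in> X" "x2 \<in> X" "x3 \<in> X" "x4 \<in> X"
  defines "c \<equiv> int (m + f (3 * m))"
  shows "\<exists>w\<in>X. \<forall>i j. 0 \<le> i \<and> i < int m \<and> 0 \<le> j \<and> j < int m \<longrightarrow>
    w (i, j) = x1 (i, j) \<and> w (c + i, j) = x2 (i, j) \<and>
    w (i, c + j) = x3 (i, j) \<and> w (c + i, c + j) = x4 (i, j)"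
proof -
  have fm: "f m \<le> f (3 * m)" "f (2 * m + f (3 * m)) \<le> f (3 * m)"
    using assms(4) by (auto intro!: monoD[OF assms(3)])
  have side: "\<exists>z\<in>X. \<forall>i j. 0 \<le> i \<and> i < int m \<and> 0 \<le> j \<and> j < int m \<longrightarrow>
      z (i, j) = x (i, j) \<and> z (c + i, j) = y (i, j)" if xy: "x \<in> X" "y \<in> X" for x y
  proof -
    obtain z where z: "z \<in> X"
      "\<And>i j. 0 \<le> i \<Longrightarrow> i < 0 + int m \<Longrightarrow> 0 \<le> j \<Longrightarrow> j < 0 + int m \<Longrightarrow> z (i, j) = x (i, j)"
      "\<And>i j. c \<le> i \<Longrightarrow> i < c + int m \<Longrightarrow> 0 \<le> j \<Longrightarrow> j < 0 + int m \<Longrightarrow>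
        z (i, j) = (\<lambda>(i, j). y (- c + i, 0 + j)) (i, j)"
      using glue[OF assms(1,2) xy(1) subshift_translate[OF assms(1) xy(2), of "- c" 0],
          of m c 0 0 0] fm by (auto simp: c_def)
    have "z (c + i, j) = y (i, j)" if "0 \<le> i" "i < int m" "0 \<le> j" "j < int m" for i j
      using z(3)[of "c + i" j] that by auto
    then show ?thesis using z(1,2) by (intro bexI[of _ z]) auto
  qed
  obtain u where u: "u \<in> X" "\<And>i j. 0 \<le> i \<Longrightarrow> i < int m \<Longrightarrow> 0 \<le> j \<Longrightarrow> j < int m \<Longrightarrow>
      u (i, j) = x1 (i, j) \<and> u (c + i, j) = x2 (i, j)"
    using side[OF assms(5,6)] by blast
  obtain v where v: "v \<in> X" "\<And>i j. 0 \<le> i \<Longrightarrow> i < int m \<Longrightarrow> 0 \<le> j \<Longrightarrow> j < int m \<Longrightarrow>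
      v (i, j) = x3 (i, j) \<and> v (c + i, j) = x4 (i, j)"
    using side[OF assms(7,8)] by blast
  define M where "M = 2 * m + f (3 * m)"
  have M: "int M = c + int m" "f M \<le> f (3 * m)" using fm by (simp_all add: M_def c_def)
  have c: "int m \<le> c" by (simp add: c_def)
  \<comment> \<open>As in a row of copies, the M-square of u hangs down, with its top m lines at
    heights 0 to m - 1. The displacement 2 c equals M + f(3 m), which is at least M + f(M).\<close>
  obtain w where w: "w \<in> X"
    "\<And>i j. 0 \<le> i \<Longrightarrow> i < 0 + int M \<Longrightarrow> - c \<le> j \<Longrightarrow> j < - c + int M \<Longrightarrow> w (i, j) = u (i, j)"
    "\<And>i j. 0 \<le> i \<Longrightarrow> i < 0 + int M \<Longrightarrow> c \<le> j \<Longrightarrow> j < c + int M \<Longrightarrow>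
      w (i, j) = (\<lambda>(i, j). v (0 + i, - c + j)) (i, j)"
    using glue[OF assms(1,2) u(1) subshift_translate[OF assms(1) v(1), of 0 "- c"],
        of M 0 0 c "- c"] M by (auto simp: c_def)
  have "w (i, j) = u (i, j)" "w (i, c + j) = v (i, j)"
    if "0 \<le> i" "i < int M" "0 \<le> j" "j < int m" for i j
    using w(2)[of i j] w(3)[of i "c + j"] that M(1) c by auto
  then show ?thesis using w(1) u(2) v(2) M(1) c by (intro bexI[of _ w]) auto
qed

text \<open>Reading off the four corners maps the large blocks onto all quadruples of
  m-blocks.\<close>

lemma card_language_doubling:
  fixes X :: "('a::finite) config set"
  assumes "subshift X" "block_gluing f X" "mono f" "f (3 * m) \<le> m"
  shows "card (language m X) ^ 4 \<le> card (language (2 * m + f (3 * m)) X)"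
proof -
  define c where "c = int (m + f (3 * m))"
  define M where "M = 2 * m + f (3 * m)"
  let ?L = "language m X"
  let ?sub = "\<lambda>s t p v. if v \<in> square m then p ((s, t) + v) else (None :: 'a option)"
  let ?quarter = "\<lambda>p. (?sub 0 0 p, ?sub c 0 p, ?sub 0 c p, ?sub c c p)"
  have "?L \<times> ?L \<times> ?L \<times> ?L \<subseteq> ?quarter ` language M X"
  proof
    fix P assume "P \<in> ?L \<times> ?L \<times> ?L \<times> ?L"
    then obtain x1 x2 x3 x4 where x: "x1 \<in> X" "x2 \<in> X" "x3 \<in> X" "x4 \<in> X"
      and P: "P = (block m x1, block m x2, block m x3, block m x4)"
      unfolding language_eq_blocks[OF assms(1)] by blast
    obtain w where w: "w \<in> X" "\<And>i j. 0 \<le> i \<Longrightarrow> i < int m \<Longrightarrow> 0 \<le> j \<Longrightarrow> j < int m \<Longrightarrow>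
        w (i, j) = x1 (i, j) \<and> w (c + i, j) = x2 (i, j) \<and>
        w (i, c + j) = x3 (i, j) \<and> w (c + i, c + j) = x4 (i, j)"
      using glue_four[OF assms x] unfolding c_def by blast
    have "int M = c + int m" "0 \<le> c" by (simp_all add: M_def c_def)
    then have eq: "?quarter (block M w) = P"
      unfolding P using w(2) by (auto simp: fun_eq_iff block_def square_def)
    show "P \<in> ?quarter ` language M X"
      unfolding eq[symmetric] by (intro imageI block_in_language w(1))
  qed
  then have "card (?L \<times> ?L \<times> ?L \<times> ?L) \<le> card (language M X)"
    by (rule surj_card_le[OF finite_language])
  then show ?thesis by (simp add: card_cartesian_product M_def power4_eq_xxxx mult.assoc)
qed

section \<open>Two-sided entropy bounds\<close>

definition entropy_term :: "'a config set \<Rightarrow> nat \<Rightarrow> real" where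
  "entropy_term X n = log 2 (real (card (language n X)))"

lemma entropy_term_nonneg:
  fixes X :: "('a::finite) config set"
  shows "subshift X \<Longrightarrow> 0 \<le> entropy_term X n"
  using card_language_pos[of X n] by (simp add: entropy_term_def)

lemma entropy_upper:
  fixes X :: "('a::finite) config set"
  assumes "subshift X" "1 \<le> n"
  shows "entropy X \<le> entropy_term X n / real n ^ 2"
  unfolding entropy_def entropy_term_def[symmetric] using assms
  by (intro cINF_lower) (auto intro!: bdd_belowI[of _ 0] divide_nonneg_nonneg entropy_term_nonneg)

text \<open>The potential \<open>\<Phi> m = m + 4 \<surd>m\<close> at most doubles under \<open>m \<mapsto> 2 m + f (3 m)\<close>, while the number of
  blocks is raised at least to its fourth power.\<close>

lemma entropy_lower:
  fixes X :: "('a::finite) config set"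
  assumes X: "subshift X" "block_gluing f X" "mono f"
    and small: "\<And>m. M0 \<le> m \<Longrightarrow> real (f (3 * m)) \<le> sqrt (real m)"
    and m: "M0 \<le> m" "1 \<le> m"
  shows "entropy_term X m / (real m + 4 * sqrt (real m)) ^ 2 \<le> entropy X"
proof -
  define \<Phi> where "\<Phi> = (\<lambda>m::nat. real m + 4 * sqrt (real m))"
  define a where "a = rec_nat m (\<lambda>_ m. 2 * m + f (3 * m))"
  have a: "a 0 = m" "a (Suc k) = 2 * a k + f (3 * a k)" for k by (simp_all add: a_def)
  have am: "m \<le> a k" for k by (induction k) (auto simp: a)
  have sq: "real (f (3 * a k)) \<le> sqrt (real (a k))" for k
    using small am[of k] m(1) by simp
  have sqle: "sqrt (real (a k)) \<le> real (a k)" for k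
  proof -
    have "1 \<le> real (a k)" using am[of k] m(2) by simp
    then have "real (a k) \<le> real (a k) * real (a k)" by simp
    then show ?thesis by (intro real_le_lsqrt) (auto simp: power2_eq_square)
  qed
  have "f (3 * a k) \<le> a k" for k
    using sq[of k] sqle[of k] by linarith
  then have "card (language (a k) X) ^ 4 \<le> card (language (a (Suc k)) X)" for k
    unfolding a by (intro card_language_doubling[OF X])
  then have grow: "entropy_term X (a (Suc k)) \<ge> 4 * entropy_term X (a k)" for k
  proof -
    assume *: "\<And>k. card (language (a k) X) ^ 4 \<le> card (language (a (Suc k)) X)"
    have p: "0 < real (card (language (a k) X))" using card_language_pos[OF X(1), of "a k"] by simp
    have "4 * entropy_term X (a k) = log 2 (real (card (language (a k) X)) ^ 4)"
      using p by (simp add: entropy_term_def log_nat_power)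
    also have "\<dots> \<le> log 2 (real (card (language (a (Suc k)) X)))"
      using *[of k] card_language_pos[OF X(1), of "a k"] card_language_pos[OF X(1), of "a (Suc k)"]
      unfolding of_nat_power[symmetric] by (subst log_le_cancel_iff) auto
    finally show ?thesis by (simp add: entropy_term_def)
  qed
  have growth: "4 ^ k * entropy_term X m \<le> entropy_term X (a k)" for k
  proof (induction k)
    case (Suc k)
    then show ?case using grow[of k] by simp
  qed (simp add: a)
  have \<Phi>_step: "\<Phi> (a (Suc k)) \<le> 2 * \<Phi> (a k)" for k
  proof -
    let ?s = "sqrt (real (a k))"
    have "real (a (Suc k)) \<le> 2 * real (a k) + ?s" using sq[of k] by (simp add: a)
    \<comment> \<open>The factor is at most 3, and 49/16 is a slightly larger rational square. It
      yields \<Phi> (a (Suc k)) \<le> 2 a + s + 4 (7/4) s = 2 a + 8 s with s the root of a = a k: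
      the coefficient 4 in the potential is the least for which this estimate closes.\<close>
    moreover have "real (a (Suc k)) \<le> (49 / 16) * real (a k)"
      using sq[of k] sqle[of k] by (simp add: a)
    then have "sqrt (real (a (Suc k))) \<le> sqrt ((7 / 4) ^ 2 * real (a k))"
      by (intro real_sqrt_le_mono) (simp add: power2_eq_square)
    then have "sqrt (real (a (Suc k))) \<le> (7 / 4) * ?s"
      by (simp add: real_sqrt_mult)
    ultimately show ?thesis by (simp add: \<Phi>_def)
  qed
  have \<Phi>: "\<Phi> (a k) \<le> 2 ^ k * \<Phi> m" for k
  proof (induction k)
    case (Suc k)
    then show ?case using \<Phi>_step[of k] by simp
  qed (simp add: a)
  have \<Phi>0: "0 < \<Phi> m" using m(2) by (simp add: \<Phi>_def add_pos_nonneg)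
  have main: "entropy_term X m / \<Phi> m ^ 2 \<le> entropy_term X n / real n ^ 2" if n: "1 \<le> n" for n
  proof -
    let ?e = "entropy_term X"
    \<comment> \<open>Tiling the (a k)-block by n-blocks costs at most one extra tile per direction;
      relative to the size 2^k this is the term (1/2)^k, which disappears as k grows.\<close>
    have *: "?e m \<le> (\<Phi> m / real n + (1 / 2) ^ k) ^ 2 * ?e n" for k
    proof -
      define q where "q = Suc (a k div n)"
      have "a k \<le> q * n"
        using n dividend_less_div_times[of n "a k"] by (simp add: q_def add.commute)
      then have "card (language (a k) X) \<le> card (language n X) ^ (q * q)"
        by (rule card_language_tiling[OF X(1)])
      then have "log 2 (real (card (language (a k) X))) \<le> log 2 (real (card (language n X)) ^ (q * q))"
        using card_language_pos[OF X(1), of "a k"] card_language_pos[OF X(1), of n]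
        unfolding of_nat_power[symmetric] by (subst log_le_cancel_iff) auto
      then have "?e (a k) \<le> real q ^ 2 * ?e n"
        using card_language_pos[OF X(1), of n]
        by (simp add: entropy_term_def log_nat_power power2_eq_square)
      with growth[of k] have le: "4 ^ k * ?e m \<le> real q ^ 2 * ?e n" by linarith
      have "real q \<le> real (a k) / real n + 1"
        using of_nat_div_le_of_nat[where ?'a = real, of "a k" n] by (simp add: q_def)
      also have "\<dots> \<le> 2 ^ k * \<Phi> m / real n + 1"
        using \<Phi>[of k] n by (intro add_right_mono divide_right_mono) (auto simp: \<Phi>_def
            intro: order_trans[rotated])
      also have "\<dots> = 2 ^ k * (\<Phi> m / real n + (1 / 2) ^ k)"
        by (simp add: distrib_left power_mult_distrib[symmetric])
      finally have "real q ^ 2 \<le> (2 ^ k * (\<Phi> m / real n + (1 / 2) ^ k)) ^ 2"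
        by (intro power_mono) auto
      also have "\<dots> = 4 ^ k * (\<Phi> m / real n + (1 / 2) ^ k) ^ 2"
        by (simp add: power_mult_distrib power2_eq_square power_mult_distrib[symmetric])
      finally have "real q ^ 2 * ?e n \<le> 4 ^ k * ((\<Phi> m / real n + (1 / 2) ^ k) ^ 2 * ?e n)"
        using entropy_term_nonneg[OF X(1), of n] mult_right_mono by (fastforce simp: mult.assoc)
      with le have "4 ^ k * ?e m \<le> 4 ^ k * ((\<Phi> m / real n + (1 / 2) ^ k) ^ 2 * ?e n)" by linarith
      then show ?thesis by simp
    qed
    have "(\<lambda>k. (\<Phi> m / real n + (1 / 2) ^ k) ^ 2 * ?e n)
        \<longlonglongrightarrow> (\<Phi> m / real n + 0) ^ 2 * ?e n"
      by (intro tendsto_intros LIMSEQ_power_zero) simp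
    then have "?e m \<le> (\<Phi> m / real n + 0) ^ 2 * ?e n"
      by (rule LIMSEQ_le_const) (use * in blast)
    then show ?thesis using \<Phi>0 n by (simp add: field_simps)
  qed
  then show ?thesis
    unfolding entropy_def entropy_term_def[symmetric] \<Phi>_def
    by (intro cINF_greatest) auto
qed

section \<open>Counting blocks on a torus\<close>

lemma periodic_mod:
  fixes g :: "int \<Rightarrow> 'b"
  assumes "\<And>i. g (i + T) = g i"
  shows "g (i mod T) = g i"
proof -
  have *: "g (i + int k * T) = g i" for i k
  proof (induction k)
    case (Suc k)
    have "i + int (Suc k) * T = (i + int k * T) + T" by (simp add: algebra_simps)
    then show ?case using Suc assms by metis
  qed simp
  have "g (i + k * T) = g i" for i k
  proof (cases "0 \<le> k")
    case True
    then show ?thesis using *[of i "nat k"] by simp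
  next
    case False
    then show ?thesis using *[of "i + k * T" "nat (- k)"] by simp
  qed
  then show ?thesis using mult_div_mod_eq[of T i] by (metis add.commute mult.commute)
qed

text \<open>The number \<open>d\<close> codes a \<open>T \<times> T\<close> torus by its digits in base \<open>a\<close>, row by row, and \<open>e\<close> numbers the
  letters. Adding the bound \<open>R\<close> on the pattern supports makes all offsets natural numbers; it only
  translates the positions, over all of which \<open>torus_ok\<close> quantifies.\<close>

definition torus_ok :: "nat \<Rightarrow> ('a \<Rightarrow> nat) \<Rightarrow> nat \<Rightarrow> 'a pattern set \<Rightarrow> nat \<Rightarrow> nat \<Rightarrow> bool" where
  "torus_ok a e R F T d \<longleftrightarrow> (\<forall>i<T. \<forall>j<T. \<forall>p\<in>F. \<exists>v\<in>dom p.
     digit a d ((i + nat (int R + fst v)) mod T * T + (j + nat (int R + snd v)) mod T)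
       \<noteq> e (the (p v)))"

definition torus_config :: "nat \<Rightarrow> ('a \<Rightarrow> nat) \<Rightarrow> nat \<Rightarrow> nat \<Rightarrow> 'a config" where
  "torus_config a e T d =
     (\<lambda>(i, j). inv e (digit a d (nat (i mod int T) * T + nat (j mod int T))))"

definition corner :: "nat \<Rightarrow> nat \<Rightarrow> nat \<Rightarrow> nat \<Rightarrow> nat \<Rightarrow> bool" where
  "corner a T n d c \<longleftrightarrow> (\<forall>i<n. \<forall>j<n. digit a d (i * T + j) = digit a c (i * n + j))"

definition count_corners ::
    "nat \<Rightarrow> ('a \<Rightarrow> nat) \<Rightarrow> nat \<Rightarrow> 'a pattern set \<Rightarrow> nat \<Rightarrow> nat \<Rightarrow> nat" where
  "count_corners a e R F T n =
     (\<Sum>c<a ^ (n * n). of_bool (\<exists>d<a ^ (T * T). torus_ok a e R F T d \<and> corner a T n d c))"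

text \<open>For fixed p and v both the offsets and \<open>e (the (p v))\<close> are constants of the
  program; e itself is never computed.\<close>

lemma rfun_count_corners:
  assumes F: "finite F" "\<forall>p\<in>F. finite (dom p)" and "rfun k A" "rfun k B"
  shows "rfun k (\<lambda>xs. count_corners a e R F (A xs) (B xs))"
proof -
  have ok: "rpred 2 (\<lambda>xs. torus_ok a e R F (hd xs) (hd (tl xs)))"
    unfolding torus_ok_def
    by (intro rpred_all rpred_finite_all rpred_finite_ex rpred_not rpred_eq rfun_digit F
        F(2)[rule_format] rfun_intros; simp)
  have corner: "rpred 4 (\<lambda>xs. corner a (hd xs) (hd (tl xs)) (hd (tl (tl xs))) (hd (tl (tl (tl xs)))))"
    unfolding corner_def by (intro rpred_all rpred_eq rfun_digit rfun_intros; simp)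
  have "rfun 2 (\<lambda>xs. count_corners a e R F (hd xs) (hd (tl xs)))"
    unfolding count_corners_def
    by (intro rfun_sum rfun_of_bool rpred_ex rpred_conj rpred_call2[OF ok] rpred_call4[OF corner]
        rfun_intros; simp)
  from rfun_call2[OF this assms(3,4)] show ?thesis .
qed

text \<open>By periodicity only positions modulo T matter, and translation by R permutes these, so
  testing T * T translated positions tests all of the plane.\<close>

lemma torus_ok_iff:
  fixes X :: "('a::finite) config set"
  assumes e: "bij_betw e UNIV {..<a}"
    and X: "X = {x. \<forall>p\<in>F. \<not> appears_in p x}"
    and R: "\<forall>p\<in>F. \<forall>v\<in>dom p. sup_norm v \<le> int R"
    and T: "0 < T"
  shows "torus_ok a e R F T d \<longleftrightarrow> torus_config a e T d \<in> X"
proof -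
  have a: "0 < a" using bij_betwE[OF e] by force
  have inv_e: "inv e (digit a d l) = b \<longleftrightarrow> digit a d l = e b" for l b
    using e digit_less[OF a, of d l] unfolding bij_betw_def
    by (metis f_inv_into_f inv_f_f lessThan_iff)
  \<comment> \<open>Position i is represented by i - R modulo T; the offset R + s, nonnegative,
    restores i + s.\<close>
  have idx: "(nat ((i - int R) mod int T) + nat (int R + s)) mod T = nat ((i + s) mod int T)"
    if "\<bar>s\<bar> \<le> int R" for i s
  proof -
    have "int ((nat ((i - int R) mod int T) + nat (int R + s)) mod T)
        = ((i - int R) mod int T + (int R + s)) mod int T"
      using that T by (simp add: zmod_int)
    also have "\<dots> = (i + s) mod int T" by (simp add: mod_add_left_eq)
    finally show ?thesis by (metis nat_int)
  qed
  have "torus_ok a e R F T d \<longleftrightarrow> (\<forall>i j. \<forall>p\<in>F. \<exists>(s, t)\<in>dom p.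
      digit a d (nat ((i + s) mod int T) * T + nat ((j + t) mod int T)) \<noteq> e (the (p (s, t))))"
    (is "_ \<longleftrightarrow> ?r")
  proof
    assume ok: "torus_ok a e R F T d"
    show ?r
    proof (intro allI ballI)
      fix i j p assume p: "p \<in> F"
      have "nat ((i - int R) mod int T) < T" "nat ((j - int R) mod int T) < T"
        using T by (simp_all add: nat_less_iff)
      from ok[unfolded torus_ok_def, rule_format, OF this p]
      obtain s t where st: "(s, t) \<in> dom p"
        "digit a d ((nat ((i - int R) mod int T) + nat (int R + s)) mod T * T
          + (nat ((j - int R) mod int T) + nat (int R + t)) mod T) \<noteq> e (the (p (s, t)))"
        by (metis prod.collapse)
      moreover have "\<bar>s\<bar> \<le> int R" "\<bar>t\<bar> \<le> int R"
        using R[rule_format, OF p st(1)] by (simp_all add: sup_norm_def)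
      ultimately show "\<exists>(s, t)\<in>dom p.
          digit a d (nat ((i + s) mod int T) * T + nat ((j + t) mod int T)) \<noteq> e (the (p (s, t)))"
        by (intro bexI[of _ "(s, t)"]) (simp_all add: idx)
    qed
  next
    assume r: ?r
    show "torus_ok a e R F T d"
      unfolding torus_ok_def
    proof (intro allI impI ballI)
      fix i j p assume ij: "i < T" "j < T" and p: "p \<in> F"
      obtain s t where st: "(s, t) \<in> dom p"
        "digit a d (nat ((int i + int R + s) mod int T) * T + nat ((int j + int R + t) mod int T))
          \<noteq> e (the (p (s, t)))"
        using r p by blast
      have "(i + nat (int R + s)) mod T = nat ((int i + int R + s) mod int T)"
        "(j + nat (int R + t)) mod T = nat ((int j + int R + t) mod int T)"
        using idx[of s "int i + int R"] idx[of t "int j + int R"] R[rule_format, OF p st(1)] ij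
        by (simp_all add: sup_norm_def)
      then show "\<exists>v\<in>dom p. digit a d ((i + nat (int R + fst v)) mod T * T
          + (j + nat (int R + snd v)) mod T) \<noteq> e (the (p v))"
        using st by (intro bexI[of _ "(s, t)"]) auto
    qed
  qed
  also have "\<dots> \<longleftrightarrow> (\<forall>i j. \<forall>p\<in>F. \<exists>(s, t)\<in>dom p.
      torus_config a e T d (i + s, j + t) \<noteq> the (p (s, t)))"
    by (simp add: torus_config_def inv_e)
  also have "\<dots> \<longleftrightarrow> (\<forall>p\<in>F. \<forall>i j. \<exists>(s, t)\<in>dom p.
      p (s, t) \<noteq> Some (torus_config a e T d (i + s, j + t)))"
  proof -
    have *: "(\<exists>(s, t)\<in>dom p. x (i + s, j + t) \<noteq> the (p (s, t))) \<longleftrightarrow>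
        (\<exists>(s, t)\<in>dom p. p (s, t) \<noteq> Some (x (i + s, j + t)))"
      for p :: "'a pattern" and x i j
      by (intro bex_cong refl) auto
    show ?thesis unfolding * by blast
  qed
  also have "\<dots> \<longleftrightarrow> torus_config a e T d \<in> X"
    by (simp add: X appears_in_def occurs_at_def Bex_def)
  finally show ?thesis .
qed

text \<open>Every admissible torus unrolls to a configuration of X, so no block outside the language
  is counted, for any T. The periodicity hypothesis gives the converse: each block of the language
  extends to a configuration that a T-torus encodes.\<close>

lemma count_corners_eq_card_language:
  fixes X :: "('a::finite) config set"
  assumes e: "bij_betw e UNIV {..<a}"
    and X: "subshift X" "X = {x. \<forall>p\<in>F. \<not> appears_in p x}"
    and R: "\<forall>p\<in>F. \<forall>v\<in>dom p. sup_norm v \<le> int R"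
    and T: "0 < T" "n \<le> T"
    and periodic: "\<And>x. x \<in> X \<Longrightarrow> \<exists>y\<in>X. block n y = block n x \<and>
      (\<forall>i j. y (i + int T, j) = y (i, j) \<and> y (i, j + int T) = y (i, j))"
  shows "count_corners a e R F T n = card (language n X)"
proof -
  have a: "0 < a" using bij_betwE[OF e] by force
  have e_less: "e b < a" for b using bij_betwE[OF e] by simp
  have inj: "inj e" using e by (simp add: bij_betw_def)
  define dec where "dec = (\<lambda>c. block n (\<lambda>(i, j). inv e (digit a c (nat i * n + nat j))))"
  define C where "C = {c. c < a ^ (n * n) \<and> (\<exists>d<a ^ (T * T). torus_ok a e R F T d \<and> corner a T n d c)}"
  have "inj_on dec C"
  proof (rule inj_onI)
    fix c c' assume c: "c \<in> C" "c' \<in> C" "dec c = dec c'"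
    show "c = c'"
    proof (rule digits2_inj)
      show "c < a ^ (n * n)" "c' < a ^ (n * n)" using c by (simp_all add: C_def)
      fix i j assume ij: "i < n" "j < n"
      have "inv e (digit a c (i * n + j)) = inv e (digit a c' (i * n + j))"
        using c(3)[unfolded dec_def block_eq_iff, rule_format, of "int i" "int j"] ij by simp
      then show "digit a c (i * n + j) = digit a c' (i * n + j)"
        using e digit_less[OF a] unfolding bij_betw_def by (metis f_inv_into_f lessThan_iff)
    qed
  qed
  moreover have "dec ` C = language n X"
  proof (intro equalityI subsetI)
    fix p assume "p \<in> dec ` C"
    then obtain c d where cd: "p = dec c" "torus_ok a e R F T d" "corner a T n d c"
      unfolding C_def by blast
    have "dec c = block n (torus_config a e T d)"
      unfolding dec_def block_eq_iff
    proof (intro allI impI)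
      fix i j assume ij: "0 \<le> i \<and> i < int n \<and> 0 \<le> j \<and> j < int n"
      have "digit a d (nat i * T + nat j) = digit a c (nat i * n + nat j)"
        using cd(3) ij unfolding corner_def by (simp add: nat_less_iff)
      then show "(case (i, j) of (i, j) \<Rightarrow> inv e (digit a c (nat i * n + nat j)))
          = torus_config a e T d (i, j)"
        using ij T by (simp add: torus_config_def)
    qed
    moreover have "torus_config a e T d \<in> X"
      using cd(2) torus_ok_iff[OF e X(2) R T(1)] by blast
    ultimately show "p \<in> language n X" using cd(1) block_in_language by metis
  next
    fix p assume "p \<in> language n X"
    then obtain x where x: "x \<in> X" "p = block n x" unfolding language_eq_blocks[OF X(1)] by blast
    obtain y where y: "y \<in> X" "block n y = block n x"
      "\<And>i j. y (i + int T, j) = y (i, j)" "\<And>i j. y (i, j + int T) = y (i, j)"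
      using periodic[OF x(1)] by blast
    obtain d where d: "d < a ^ (T * T)"
      "\<And>i j. i < T \<Longrightarrow> j < T \<Longrightarrow> digit a d (i * T + j) = e (y (int i, int j))"
      using ex_digits2[of T "\<lambda>i j. e (y (int i, int j))" a] e_less by blast
    obtain c where c: "c < a ^ (n * n)"
      "\<And>i j. i < n \<Longrightarrow> j < n \<Longrightarrow> digit a c (i * n + j) = e (y (int i, int j))"
      using ex_digits2[of n "\<lambda>i j. e (y (int i, int j))" a] e_less by blast
    have "torus_config a e T d (i, j) = y (i, j)" for i j
    proof -
      have "nat (i mod int T) < T" "nat (j mod int T) < T" using T by (simp_all add: nat_less_iff)
      then have "torus_config a e T d (i, j) = y (i mod int T, j mod int T)"
        using d(2) inj T by (simp add: torus_config_def)
      also have "\<dots> = y (i, j mod int T)"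
        by (rule periodic_mod[of "\<lambda>i. y (i, j mod int T)"]) (rule y(3))
      also have "\<dots> = y (i, j)"
        by (rule periodic_mod[of "\<lambda>j. y (i, j)"]) (rule y(4))
      finally show ?thesis .
    qed
    then have "torus_config a e T d = y" by auto
    then have "torus_ok a e R F T d" using y(1) torus_ok_iff[OF e X(2) R T(1)] by blast
    moreover have "corner a T n d c" unfolding corner_def using c(2) d(2) T(2) by simp
    ultimately have "c \<in> C" unfolding C_def using c(1) d(1) by blast
    moreover have "dec c = block n y"
      unfolding dec_def block_eq_iff using c(2) inj by (simp add: nat_less_iff)
    ultimately show "p \<in> dec ` C" using x(2) y(2) by (metis imageI)
  qed
  ultimately have "card (language n X) = card C" by (metis card_image)
  moreover have "{..<a ^ (n * n)} \<inter> {c. \<exists>d<a ^ (T * T). torus_ok a e R F T d \<and> corner a T n d c} = C"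
    unfolding C_def by auto
  ultimately show ?thesis unfolding count_corners_def by (simp add: sum_of_bool_eq)
qed

section \<open>Computability of the entropy\<close>

lemma smallo_ln_bound:
  fixes f :: "nat \<Rightarrow> nat"
  assumes "(\<lambda>n. real (f n)) \<in> o(\<lambda>n. ln (real n))" "0 < c"
  obtains M where "1 \<le> M" "\<And>n. M \<le> n \<Longrightarrow> real (f n) \<le> c * ln (real n)"
proof -
  have "eventually (\<lambda>n. norm (real (f n)) \<le> c * norm (ln (real n))) sequentially"
    by (rule landau_o.smallD[OF assms])
  then obtain M where M: "\<And>n. M \<le> n \<Longrightarrow> norm (real (f n)) \<le> c * norm (ln (real n))"
    unfolding eventually_sequentially by blast
  show thesis
    by (rule that[of "max M 1"]) (use M in force)+
qed

lemma smallo_ln_exp_bound: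
  fixes f :: "nat \<Rightarrow> nat" and a r :: nat
  assumes "(\<lambda>n. real (f n)) \<in> o(\<lambda>n. ln (real n))" "1 \<le> a"
  obtains M where "1 \<le> M" "\<And>n. M \<le> n \<Longrightarrow> f (n + a ^ (r * (2 * n)) * (2 * n)) \<le> n"
proof -
  \<comment> \<open>Chosen so that ln N \<le> 2 r n ln a + ln (3 n) \<le> c n: the length N is only
    exponential in n, and f(N) \<le> (ln N) / c gives a gap of at most n.\<close>
  define c where "c = 2 * real r * ln (real a) + 3"
  have c: "0 < c" using assms(2) by (simp add: c_def add_nonneg_pos)
  obtain M where M: "1 \<le> M" "\<And>n. M \<le> n \<Longrightarrow> real (f n) \<le> 1 / c * ln (real n)"
    using smallo_ln_bound[OF assms(1), of "1 / c"] c by auto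
  have "f (n + a ^ (r * (2 * n)) * (2 * n)) \<le> n" if n: "M \<le> n" for n
  proof -
    define N where "N = n + a ^ (r * (2 * n)) * (2 * n)"
    have n1: "1 \<le> n" using n M(1) by linarith
    have "1 \<le> a ^ (r * (2 * n))" using assms(2) by simp
    then have "n \<le> a ^ (r * (2 * n)) * n" by simp
    then have "N \<le> a ^ (r * (2 * n)) * (3 * n)" unfolding N_def by linarith
    then have "real N \<le> real (a ^ (r * (2 * n)) * (3 * n))" by (simp only: of_nat_le_iff)
    moreover have "0 < real N" using n1 unfolding N_def of_nat_0_less_iff by linarith
    ultimately have "ln (real N) \<le> ln (real (a ^ (r * (2 * n)) * (3 * n)))" by (intro ln_mono)
    also have "\<dots> = real (r * (2 * n)) * ln (real a) + ln (3 * real n)"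
      using assms(2) n1 by (simp add: ln_mult ln_realpow)
    also have "\<dots> \<le> real (r * (2 * n)) * ln (real a) + 3 * real n"
      using n1 ln_le_minus_one[of "3 * real n"] by simp
    also have "\<dots> = c * real n" by (simp add: c_def algebra_simps)
    finally have "1 / c * ln (real N) \<le> real n" using c by (simp add: field_simps)
    moreover have "M \<le> N" using n by (simp add: N_def)
    ultimately have "real (f N) \<le> real n" using M(2) by force
    then show ?thesis by (simp add: N_def)
  qed
  then show thesis using that M(1) by blast
qed

lemma smallo_ln_sqrt_bound:
  fixes f :: "nat \<Rightarrow> nat"
  assumes "(\<lambda>n. real (f n)) \<in> o(\<lambda>n. ln (real n))"
  obtains M where "1 \<le> M" "\<And>m. M \<le> m \<Longrightarrow> real (f (3 * m)) \<le> sqrt (real m)"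
proof -
  \<comment> \<open>The factor 1/4 cancels the 4 in ln (3 m) = 2 ln (sqrt (3 m)) \<le> 2 sqrt (4 m)
    = 4 sqrt m.\<close>
  obtain M where M: "1 \<le> M" "\<And>n. M \<le> n \<Longrightarrow> real (f n) \<le> 1 / 4 * ln (real n)"
    using smallo_ln_bound[OF assms, of "1 / 4"] by auto
  have "real (f (3 * m)) \<le> sqrt (real m)" if m: "M \<le> m" for m
  proof -
    have m1: "1 \<le> m" using m M(1) by linarith
    have "ln (real (3 * m)) = 2 * ln (sqrt (real (3 * m)))"
      using m1 by (simp add: ln_sqrt)
    also have "\<dots> \<le> 2 * sqrt (real (3 * m))"
      using m1 ln_le_minus_one[of "sqrt (real (3 * m))"] by simp
    also have "\<dots> \<le> 2 * sqrt (4 * real m)" by simp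
    also have "\<dots> = 4 * sqrt (real m)" by (simp add: real_sqrt_mult)
    finally show ?thesis using M(2)[of "3 * m"] m by simp
  qed
  then show thesis using that M(1) by blast
qed

lemma floor_log_bounds:
  assumes "1 \<le> n"
  shows "real (floor_log n) \<le> log 2 (real n)" "log 2 (real n) < real (floor_log n) + 1"
proof -
  have *: "2 ^ floor_log n \<le> n" "n < 2 ^ Suc (floor_log n)"
    using floor_log_exp2_le[of n] floor_log_exp2_gt[of n] assms by auto
  have "real (2 ^ floor_log n) \<le> real n" using *(1) by (simp only: of_nat_le_iff)
  then show "real (floor_log n) \<le> log 2 (real n)"
    using assms by (simp add: le_log_iff powr_realpow)
  have "real n < real (2 ^ Suc (floor_log n))" using *(2) by (simp only: of_nat_less_iff)
  then have "log 2 (real n) < log 2 (2 ^ Suc (floor_log n))"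
    using assms by (subst log_less_cancel_iff) auto
  also have "\<dots> = real (Suc (floor_log n)) * log 2 2" by (rule log_nat_power) simp
  finally show "log 2 (real n) < real (floor_log n) + 1" by simp
qed

lemma entropy_term_le_square:
  fixes X :: "('a::finite) config set"
  assumes "subshift X"
  shows "entropy_term X m \<le> real m ^ 2 * entropy_term X 1"
proof -
  have "card (language m X) \<le> card (language 1 X) ^ (m * m)"
    by (rule card_language_tiling[OF assms]) simp
  then have "log 2 (real (card (language m X))) \<le> log 2 (real (card (language 1 X)) ^ (m * m))"
    using card_language_pos[OF assms, of m] card_language_pos[OF assms, of 1]
    unfolding of_nat_power[symmetric] by (subst log_le_cancel_iff) auto
  then show ?thesis
    using card_language_pos[OF assms, of 1]
    by (simp add: entropy_term_def log_nat_power power2_eq_square)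
qed

text \<open>Both the entropy and its approximation lie in [E - \<epsilon>, E], so the two errors do
  not add up. With s the root of m, the gluing bound loses at most 8 L / s, where L bounds E, and
  the floor loses at most 1 / m^2. The summand 1 in the hypothesis covers the floor even if L =
  0.\<close>

lemma entropy_approx:
  fixes X :: "('a::finite) config set"
  assumes X: "subshift X" "block_gluing f X" "mono f"
    and small: "\<And>m. M0 \<le> m \<Longrightarrow> real (f (3 * m)) \<le> sqrt (real m)"
    and m: "M0 \<le> m" "1 \<le> m"
    and \<epsilon>: "0 < \<epsilon>" "8 * (entropy_term X 1 + 1) \<le> \<epsilon> * sqrt (real m)"
  shows "\<bar>entropy X - real (floor_log (card (language m X))) / real m ^ 2\<bar> \<le> \<epsilon>"
proof -
  define s where "s = sqrt (real m)"
  define L where "L = entropy_term X 1"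
  define E where "E = entropy_term X m / real m ^ 2"
  have s: "1 \<le> s" "real m = s ^ 2" using m(2) by (auto simp: s_def)
  have L: "0 \<le> L" unfolding L_def by (rule entropy_term_nonneg[OF X(1)])
  have E: "0 \<le> E" "E \<le> L"
    using entropy_term_nonneg[OF X(1), of m] entropy_term_le_square[OF X(1), of m] m(2)
    by (simp_all add: E_def L_def field_simps)
  have upper: "entropy X \<le> E" unfolding E_def by (rule entropy_upper[OF X(1) m(2)])
  have "entropy_term X m / (real m + 4 * s) ^ 2 \<le> entropy X"
    unfolding s_def by (rule entropy_lower[OF X small m])
  moreover have "entropy_term X m / (real m + 4 * s) ^ 2 = E * (s / (s + 4)) ^ 2"
    using s by (simp add: E_def field_simps power2_eq_square)
  moreover have "1 - 8 / s \<le> (s / (s + 4)) ^ 2"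
  proof -
    have "1 - 8 / s \<le> 1 - 8 / (s + 4)" using s(1) by (intro diff_left_mono divide_left_mono) auto
    also have "\<dots> \<le> 1 - 8 / (s + 4) + (4 / (s + 4)) ^ 2" by simp
    also have "\<dots> = (1 - 4 / (s + 4)) ^ 2" by (simp add: power2_diff)
    also have "1 - 4 / (s + 4) = s / (s + 4)" using s by (simp add: field_simps)
    finally show ?thesis .
  qed
  then have "E * (1 - 8 / s) \<le> E * (s / (s + 4)) ^ 2" using E(1) by (rule mult_left_mono)
  ultimately have "E - E * (8 / s) \<le> entropy X" by (simp add: right_diff_distrib)
  moreover have "E * (8 / s) \<le> L * (8 / s)" using E s by (intro mult_right_mono) auto
  moreover have "L * (8 / s) \<le> \<epsilon>" using \<epsilon>(2) s by (simp add: s_def[symmetric] L_def field_simps)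
  ultimately have lower: "E - \<epsilon> \<le> entropy X" by linarith
  have c: "1 \<le> card (language m X)" by (rule card_language_pos[OF X(1)])
  have "real (floor_log (card (language m X))) \<le> entropy_term X m"
    "entropy_term X m - 1 \<le> real (floor_log (card (language m X)))"
    using floor_log_bounds[OF c] by (simp_all add: entropy_term_def)
  then have "real (floor_log (card (language m X))) / real m ^ 2 \<le> E"
    "E - 1 / real m ^ 2 \<le> real (floor_log (card (language m X))) / real m ^ 2"
    unfolding E_def diff_divide_distrib[symmetric] by (intro divide_right_mono; simp)+
  moreover have "1 / real m ^ 2 \<le> \<epsilon>"
  proof -
    have "1 \<le> \<epsilon> * s" using \<epsilon>(2) L by (simp add: s_def L_def)
    also have "\<dots> \<le> \<epsilon> * (s ^ 2) ^ 2"
      using \<epsilon>(1) s(1) power_increasing[of 1 4 s] by (intro mult_left_mono) auto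
    finally show ?thesis using m(2) \<epsilon>(1) s by (simp add: divide_simps)
  qed
  ultimately show ?thesis using upper lower by linarith
qed

theorem proposition40:
  fixes X :: "('a::finite) config set" and f :: "nat \<Rightarrow> nat"
  assumes "subshift X"
    and "finite_type X"
    and "block_gluing f X"
    and "mono f"
    and "(\<lambda>n. real (f n)) \<in> o(\<lambda>n. ln (real n))"
    and "\<And>n. f n \<le> n"
  shows "computable_real (entropy X)"
proof -
  define a where "a = card (UNIV :: 'a set)"
  have a: "1 \<le> a" by (simp add: a_def Suc_le_eq card_gt_0_iff)
  obtain e :: "'a \<Rightarrow> nat" where e: "bij_betw e UNIV {..<a}"
    using ex_bij_betw_finite_nat[of "UNIV :: 'a set"] by (auto simp: a_def lessThan_atLeast0)
  obtain F where F: "finite F" "\<forall>p\<in>F. finite (dom p)" "X = {x. \<forall>p\<in>F. \<not> appears_in p x}"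
    using assms(2) unfolding finite_type_def by blast
  obtain R where R: "\<forall>p\<in>F. \<forall>v\<in>dom p. sup_norm v \<le> int R"
    using finite_patterns_bounded[OF F(1,2)] by blast
  obtain r where r: "0 < r" "window_determined r X"
    using finite_type_window_determined[OF assms(2)] by blast
  obtain M1 where M1: "1 \<le> M1" "\<And>n. M1 \<le> n \<Longrightarrow> f (n + a ^ (r * (2 * n)) * (2 * n)) \<le> n"
    using smallo_ln_exp_bound[OF assms(5) a, of r] by blast
  obtain M2 where M2: "1 \<le> M2" "\<And>m. M2 \<le> m \<Longrightarrow> real (f (3 * m)) \<le> sqrt (real m)"
    using smallo_ln_sqrt_bound[OF assms(5)] by blast
  define K where "K = 8 * (entropy_term X 1 + 1)"
  \<comment> \<open>A constant of the program whose value is merely known to exist. Its last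
    component makes K at most the root of m0.\<close>
  define m0 where "m0 = max (max r (max M1 M2)) (nat \<lceil>K ^ 2\<rceil>)"
  \<comment> \<open>The error is of order 1 / sqrt m, so each further bit of precision quadruples
    the block size.\<close>
  define m where "m = (\<lambda>z. m0 * 4 ^ z)"
  \<comment> \<open>The common period from \<open>periodic_extension\<close>, written as an
    expression in n with a and r constant.\<close>
  define T where "T = (\<lambda>n. fact (n + a ^ (r * (2 * n)) * (2 * n)) :: nat)"
  define count where "count = (\<lambda>n. count_corners a e R F (T n) n)"
  have m0_le: "m0 \<le> m z" for z by (simp add: m_def)
  have large: "r \<le> m z" "M1 \<le> m z" "M2 \<le> m z" for z
    using m0_le[of z] unfolding m0_def by linarith+
  have m1: "1 \<le> m z" for z using large(2)[of z] M1(1) by linarith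
  have count: "count (m z) = card (language (m z) X)" for z
    unfolding count_def
  proof (rule count_corners_eq_card_language[OF e assms(1) F(3) R])
    show "0 < T (m z)" by (simp add: T_def)
    have "m z \<le> m z + a ^ (r * (2 * m z)) * (2 * m z)" by simp
    also have "\<dots> \<le> T (m z)" unfolding T_def by (rule fact_ge_self)
    finally show "m z \<le> T (m z)" .
    show "\<exists>y\<in>X. block (m z) y = block (m z) x \<and>
        (\<forall>i j. y (i + int (T (m z)), j) = y (i, j) \<and> y (i, j + int (T (m z))) = y (i, j))"
      if "x \<in> X" for x
      using periodic_extension[OF assms(1,3,4) r(2,1) large(1) _ that] M1(2)[OF large(2)]
      unfolding T_def a_def by blast
  qed
  have "rfun 1 (\<lambda>xs. prod_encode (2 * floor_log (count (m (hd xs))), 2 * (m (hd xs))\<^sup>2))"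
    unfolding count_def T_def m_def
    by (intro rfun_prod_encode rfun_floor_log rfun_count_corners F rfun_intros; simp)
  then have "computable_fun (\<lambda>z. prod_encode (2 * floor_log (count (m z)), 2 * (m z)\<^sup>2))"
    by (rule rfun_1_imp_computable_fun)
  then show ?thesis
  proof (rule computable_realI)
    fix z
    show "0 < (m z)\<^sup>2" using m1[of z] by simp
    have "K \<le> sqrt (real m0)"
    proof (rule real_le_rsqrt)
      show "K\<^sup>2 \<le> real m0" unfolding m0_def by linarith
    qed
    also have "\<dots> = (1 / 2) ^ z * 2 ^ z * sqrt (real m0)"
      by (simp flip: power_mult_distrib)
    also have "\<dots> = (1 / 2) ^ z * sqrt (real (m z))"
      by (simp add: m_def real_sqrt_mult real_sqrt_power)
    finally have "K \<le> (1 / 2) ^ z * sqrt (real (m z))" .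
    then show "\<bar>entropy X - real (floor_log (count (m z))) / real ((m z)\<^sup>2)\<bar> \<le> (1 / 2) ^ z"
      using entropy_approx[OF assms(1,3,4) M2(2) large(3) m1, where \<epsilon> = "(1 / 2) ^ z"]
      by (simp add: K_def count)
  qed
qed

end
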